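(* Let $D,m\ge 1$, let $0\ne w\in\mathrm{Sym}^D\mathbb{C}^m$ be a polystable form, $G=\mathrm{GL}_m$, and let $\Phi_w\in\mathcal{O}(\overline{Gw})$ be its fundamental invariant. Then: (1) The zero set of $\Phi_w$ in $\overline{Gw}$ equals the boundary $\overline{Gw}\setminus Gw$. (2) The ring $\mathcal{O}(Gw)$ of regular functions on $Gw$ equals the localization of $\mathcal{O}(\overline{Gw})$ with respect to $\Phi_w$, i.e. $$\mathcal{O}(Gw)=\mathcal{O}(\overline{Gw})_{\Phi_w}=\Big\{\frac{f}{(\Phi_w)^s}\;\Big|\; f\in\mathcal{O}(\overline{Gw}),\ s\in\mathbb{N}\Big\}.$$
   Context: Work over $\mathbb{C}$. $\mathrm{Sym}^D\mathbb{C}^m$ is the space of forms of degree $D$ in $m$ variables with the natural action of $G=\mathrm{GL}_m$. A form $w$ is polystable if its $\mathrm{SL}_m$-orbit is closed. $\overline{Gw}$ is the closure of the orbit $Gw$, $\mathcal{O}(\overline{Gw})$ its coordinate ring, and $\mathcal{O}(\overline{Gw})^{\mathrm{SL}_m}_d$ the space of $\mathrm{SL}_m$-invariant functions in it homogeneous of degree $d$ (under scalar multiplication). For nonzero polystable $w$ each of these spaces is at most one-dimensional, and for some $d>0$ it is nonzero. The minimal degree $e(w)$ is the smallest positive $d$ with $\mathcal{O}(\overline{Gw})^{\mathrm{SL}_m}_d\neq0$. The fundamental invariant $\Phi_w$ of $w$ is the unique element of $\mathcal{O}(\overline{Gw})^{\mathrm{SL}_m}_{e(w)}$ with $\Phi_w(w)=1$.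 *)

theory Defs
  imports
    "HOL-Analysis.Analysis"
    "HOL-Library.Poly_Mapping"
    "HOL-Algebra.QuotRing"
begin

section \<open>Polynomials in several variables\<close>

text \<open>
  A monomial in the variables \<open>'v\<close> is its exponent vector \<open>'v \<Rightarrow>\<^sub>0 nat\<close>; addition and multiplication
  of polynomials are those of \<open>Poly_Mapping\<close> (multiplication is convolution).
\<close>

type_synonym 'v mpoly = "('v \<Rightarrow>\<^sub>0 nat) \<Rightarrow>\<^sub>0 complex"

definition mconst :: "complex \<Rightarrow> 'v mpoly" where
  "mconst c = Poly_Mapping.single 0 c"

definition mvar :: "'v \<Rightarrow> 'v mpoly" where
  "mvar i = Poly_Mapping.single (Poly_Mapping.single i 1) 1"

definition monom_value :: "('v \<Rightarrow> 'b::comm_semiring_1) \<Rightarrow> ('v \<Rightarrow>\<^sub>0 nat) \<Rightarrow> 'b" where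
  "monom_value x \<mu> = (\<Prod>i\<in>Poly_Mapping.keys \<mu>. x i ^ Poly_Mapping.lookup \<mu> i)"

text \<open>
  Substitution of the values \<open>x\<close> for the variables, in a commutative algebra \<open>'b\<close> whose structure
  map is \<open>c :: complex \<Rightarrow> 'b\<close>.
\<close>

definition mpoly_subst :: "(complex \<Rightarrow> 'b::comm_semiring_1) \<Rightarrow> ('v \<Rightarrow> 'b) \<Rightarrow> 'v mpoly \<Rightarrow> 'b" where
  "mpoly_subst c x p =
     (\<Sum>\<mu>\<in>Poly_Mapping.keys p. c (Poly_Mapping.lookup p \<mu>) * monom_value x \<mu>)"


section \<open>Forms and the action of the general linear group\<close>

text \<open>
  The number of variables is \<open>CARD('n)\<close>; the variables are the standard basis of $C^m$, so that
  forms of degree \<open>D\<close> are the elements of the symmetric power $Sym^D C^m$. A matrix \<open>g\<close> acts by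
  $g (v_1 ... v_D) = (g v_1) ... (g v_D)$, that is, it replaces the variable \<open>j\<close> by the \<open>j\<close>-th
  column of \<open>g\<close>.
\<close>

definition forms :: "nat \<Rightarrow> 'n::finite mpoly set" where
  "forms D = {p. \<forall>\<mu>\<in>Poly_Mapping.keys p. (\<Sum>i\<in>UNIV. Poly_Mapping.lookup \<mu> i) = D}"

definition GL :: "(complex ^ 'n ^ 'n) set" where
  "GL = {g. invertible g}"

definition SL :: "(complex ^ 'n ^ 'n) set" where
  "SL = {g. det g = 1}"

definition act :: "complex ^ 'n ^ 'n \<Rightarrow> 'n::finite mpoly \<Rightarrow> 'n mpoly" where
  "act g p = mpoly_subst mconst (\<lambda>j. \<Sum>i\<in>UNIV. mconst (g $ i $ j) * mvar i) p"

definition GL_orbit :: "'n::finite mpoly \<Rightarrow> 'n mpoly set" where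
  "GL_orbit w = (\<lambda>g. act g w) ` GL"

definition SL_orbit :: "'n::finite mpoly \<Rightarrow> 'n mpoly set" where
  "SL_orbit w = (\<lambda>g. act g w) ` SL"


section \<open>The Zariski topology on the space of forms\<close>

text \<open>
  A polynomial function on the space of forms is a polynomial in the coefficients of the form. The
  coordinates are therefore indexed by monomials; those of degree other than \<open>D\<close> vanish
  on \<open>forms D\<close>.
\<close>

definition poly_fun :: "('n \<Rightarrow>\<^sub>0 nat) mpoly \<Rightarrow> 'n mpoly \<Rightarrow> complex" where
  "poly_fun P v = mpoly_subst (\<lambda>a. a) (Poly_Mapping.lookup v) P"

definition zariski :: "nat \<Rightarrow> 'n::finite mpoly topology" where
  "zariski D = topology (\<lambda>U. \<exists>I. U = {v \<in> forms D. \<exists>P\<in>I. poly_fun P v \<noteq> 0})"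

lemma monom_value_superset:
  assumes "finite A" "Poly_Mapping.keys \<mu> \<subseteq> A"
  shows "monom_value x \<mu> = (\<Prod>i\<in>A. x i ^ Poly_Mapping.lookup \<mu> i)"
  unfolding monom_value_def
  by (rule prod.mono_neutral_left) (use assms in \<open>auto simp: in_keys_iff\<close>)

lemma monom_value_add: "monom_value x (\<mu> + \<nu>) = monom_value x \<mu> * monom_value x \<nu>"
proof -
  let ?A = "Poly_Mapping.keys \<mu> \<union> Poly_Mapping.keys \<nu>"
  have sub: "Poly_Mapping.keys (\<mu> + \<nu>) \<subseteq> ?A"
    by (rule Poly_Mapping.keys_add)
  show ?thesis
    by (simp add: monom_value_superset[of ?A] sub lookup_add power_add prod.distrib)
qed

lemma mpoly_subst_superset:
  assumes "finite A" "Poly_Mapping.keys p \<subseteq> A"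
  shows "mpoly_subst (\<lambda>a. a) x p = (\<Sum>\<mu>\<in>A. Poly_Mapping.lookup p \<mu> * monom_value x \<mu>)"
  unfolding mpoly_subst_def
  by (rule sum.mono_neutral_left) (use assms in \<open>auto simp: in_keys_iff\<close>)

lemma mpoly_subst_add: "mpoly_subst (\<lambda>a. a) x (p + q) = mpoly_subst (\<lambda>a. a) x p + mpoly_subst (\<lambda>a. a) x q"
proof -
  let ?A = "Poly_Mapping.keys p \<union> Poly_Mapping.keys q"
  have sub: "Poly_Mapping.keys (p + q) \<subseteq> ?A"
    by (rule Poly_Mapping.keys_add)
  show ?thesis
    by (simp add: mpoly_subst_superset[of ?A] sub lookup_add distrib_right sum.distrib)
qed

lemma mpoly_subst_zero [simp]: "mpoly_subst c x 0 = 0"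
  by (simp add: mpoly_subst_def)

lemma mpoly_subst_sum: "mpoly_subst (\<lambda>a. a) x (sum f A) = (\<Sum>a\<in>A. mpoly_subst (\<lambda>a. a) x (f a))"
  by (induction A rule: infinite_finite_induct) (simp_all add: mpoly_subst_add)

lemma mpoly_subst_single:
  "mpoly_subst (\<lambda>a. a) x (Poly_Mapping.single \<mu> a) = a * monom_value x \<mu>"
  by (subst mpoly_subst_superset[of "{\<mu>}"]) (auto split: if_splits)

lemma mpoly_eq_sum_single:
  "(\<Sum>\<mu>\<in>Poly_Mapping.keys p. Poly_Mapping.single \<mu> (Poly_Mapping.lookup p \<mu>)) = p"
  by (rule poly_mapping_eqI)
     (auto simp: lookup_sum lookup_single when_def in_keys_iff)

lemma mpoly_subst_mult:
  "mpoly_subst (\<lambda>a. a) x (p * q) = mpoly_subst (\<lambda>a. a) x p * mpoly_subst (\<lambda>a. a) x q"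
proof -
  let ?s = "\<lambda>p \<mu>. Poly_Mapping.single \<mu> (Poly_Mapping.lookup p \<mu>)"
  have "p * q = (\<Sum>\<mu>\<in>Poly_Mapping.keys p. \<Sum>\<nu>\<in>Poly_Mapping.keys q. ?s p \<mu> * ?s q \<nu>)"
    unfolding sum_product[symmetric] mpoly_eq_sum_single ..
  also have "mpoly_subst (\<lambda>a. a) x \<dots> = mpoly_subst (\<lambda>a. a) x p * mpoly_subst (\<lambda>a. a) x q"
    by (simp add: mpoly_subst_sum mult_single mpoly_subst_single monom_value_add
        mpoly_subst_def[of "\<lambda>a. a" x p] mpoly_subst_def[of "\<lambda>a. a" x q] sum_product mult_ac)
  finally show ?thesis .
qed

lemma poly_fun_mult: "poly_fun (P * Q) v = poly_fun P v * poly_fun Q v"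
  by (simp add: poly_fun_def mpoly_subst_mult)

lemma poly_fun_one [simp]: "poly_fun 1 v = 1"
  by (simp add: poly_fun_def mpoly_subst_single monom_value_def flip: single_one)

lemma istopology_zariski:
  "istopology (\<lambda>U. \<exists>I. U = {v \<in> (forms D :: 'n::finite mpoly set). \<exists>P\<in>I. poly_fun P v \<noteq> 0})"
  (is "istopology (\<lambda>U. \<exists>I. U = ?U I)")
proof -
  have inter: "?U I \<inter> ?U J = ?U ((\<lambda>(P, Q). P * Q) ` (I \<times> J))" for I J
    by (auto simp: poly_fun_mult)
  have "\<exists>K. ?U I \<inter> ?U J = ?U K" for I J
    using inter by (rule exI)
  moreover have "\<exists>K. \<Union>\<K> = ?U K" if \<K>: "\<forall>U\<in>\<K>. \<exists>I. U = ?U I" for \<K>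
  proof -
    obtain f where f: "\<forall>U\<in>\<K>. U = ?U (f U)"
      using bchoice[OF \<K>] by blast
    have "\<Union>\<K> = (\<Union>U\<in>\<K>. ?U (f U))"
    proof -
      have "\<Union>\<K> = (\<Union>U\<in>\<K>. U)" by simp
      also have "\<dots> = (\<Union>U\<in>\<K>. ?U (f U))"
        by (rule SUP_cong[OF refl]) (rule f[rule_format])
      finally show ?thesis .
    qed
    also have "\<dots> = ?U (\<Union>U\<in>\<K>. f U)"
      by blast
    finally show ?thesis by blast
  qed
  ultimately show ?thesis
    unfolding istopology_def by blast
qed

lemma openin_zariski:
  "openin (zariski D) U \<longleftrightarrow> (\<exists>I. U = {v \<in> forms D. \<exists>P\<in>I. poly_fun P v \<noteq> 0})"
  by (simp add: zariski_def topology_inverse'[OF istopology_zariski])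

lemma topspace_zariski [simp]: "topspace (zariski D) = forms D"
proof
  show "topspace (zariski D) \<subseteq> forms D"
    unfolding topspace_def openin_zariski by blast
  have "openin (zariski D) (forms D)"
    unfolding openin_zariski by (rule exI[of _ "{1}"]) auto
  then show "forms D \<subseteq> topspace (zariski D)"
    by (rule openin_subset)
qed

lemma closedin_zariski:
  "closedin (zariski D) S \<longleftrightarrow> (\<exists>I. S = {v \<in> forms D. \<forall>P\<in>I. poly_fun P v = 0})"
proof
  assume "closedin (zariski D) S"
  then obtain I where S: "S \<subseteq> forms D"
      and I: "forms D - S = {v \<in> forms D. \<exists>P\<in>I. poly_fun P v \<noteq> 0}"
    unfolding closedin_def openin_zariski by auto
  have "S = forms D - (forms D - S)"
    using S by blast
  also have "\<dots> = {v \<in> forms D. \<forall>P\<in>I. poly_fun P v = 0}"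
    unfolding I by blast
  finally show "\<exists>I. S = {v \<in> forms D. \<forall>P\<in>I. poly_fun P v = 0}" by blast
next
  assume "\<exists>I. S = {v \<in> forms D. \<forall>P\<in>I. poly_fun P v = 0}"
  then obtain I where I: "S = {v \<in> forms D. \<forall>P\<in>I. poly_fun P v = 0}" by blast
  have "forms D - S = {v \<in> forms D. \<exists>P\<in>I. poly_fun P v \<noteq> 0}"
    unfolding I by blast
  then show "closedin (zariski D) S"
    unfolding closedin_def openin_zariski I by auto
qed

definition polystable :: "nat \<Rightarrow> 'n::finite mpoly \<Rightarrow> bool" where
  "polystable D w \<longleftrightarrow> closedin (zariski D) (SL_orbit w)"

definition orbit_closure :: "nat \<Rightarrow> 'n::finite mpoly \<Rightarrow> 'n mpoly set" where
  "orbit_closure D w = zariski D closure_of GL_orbit w"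


section \<open>Rings of functions\<close>

text \<open>
  Functions on \<open>X\<close> are represented as extensional functions (\<open>undefined\<close> outside \<open>X\<close>), so that
  HOL equality is equality on \<open>X\<close>.
\<close>

definition fun_ring :: "'x set \<Rightarrow> ('x \<Rightarrow> complex) set \<Rightarrow> ('x \<Rightarrow> complex) ring" where
  "fun_ring X A =
     \<lparr>carrier = A,
      mult = (\<lambda>f g. \<lambda>v\<in>X. f v * g v),
      one = (\<lambda>v\<in>X. 1),
      zero = (\<lambda>v\<in>X. 0),
      add = (\<lambda>f g. \<lambda>v\<in>X. f v + g v)\<rparr>"

text \<open>The coordinate ring of a Zariski closed set \<open>X\<close> of forms.\<close>

definition coord_ring :: "'n mpoly set \<Rightarrow> ('n mpoly \<Rightarrow> complex) ring" where
  "coord_ring X = fun_ring X (range (\<lambda>P. restrict (poly_fun P) X))"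

text \<open>
  The ring of regular functions on a locally closed set \<open>X\<close> of forms of degree \<open>D\<close>: functions that
  near each point of \<open>X\<close> are a quotient of polynomial functions.
\<close>

definition regular_at :: "nat \<Rightarrow> 'n::finite mpoly set \<Rightarrow> ('n mpoly \<Rightarrow> complex) \<Rightarrow> 'n mpoly \<Rightarrow> bool" where
  "regular_at D X f u \<longleftrightarrow>
     (\<exists>U P Q. openin (zariski D) U \<and> u \<in> U \<and>
        (\<forall>v \<in> U \<inter> X. poly_fun Q v \<noteq> 0 \<and> f v = poly_fun P v / poly_fun Q v))"

definition regular_ring :: "nat \<Rightarrow> 'n::finite mpoly set \<Rightarrow> ('n mpoly \<Rightarrow> complex) ring" where
  "regular_ring D X = fun_ring X {f \<in> extensional X. \<forall>u\<in>X. regular_at D X f u}"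


section \<open>Localization at the powers of an element\<close>

text \<open>The pair \<open>(f, s)\<close> stands for the fraction $f / a^s$.\<close>

definition frac_rel :: "('a, 'm) ring_scheme \<Rightarrow> 'a \<Rightarrow> (('a \<times> nat) \<times> ('a \<times> nat)) set" where
  "frac_rel R a =
     {((f, s), (g, t)) | f s g t. f \<in> carrier R \<and> g \<in> carrier R \<and>
        (\<exists>u::nat. a [^]\<^bsub>R\<^esub> u \<otimes>\<^bsub>R\<^esub> (a [^]\<^bsub>R\<^esub> t \<otimes>\<^bsub>R\<^esub> f) = a [^]\<^bsub>R\<^esub> u \<otimes>\<^bsub>R\<^esub> (a [^]\<^bsub>R\<^esub> s \<otimes>\<^bsub>R\<^esub> g))}"

definition fraction :: "('a, 'm) ring_scheme \<Rightarrow> 'a \<Rightarrow> 'a \<Rightarrow> nat \<Rightarrow> ('a \<times> nat) set" where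
  "fraction R a f s = frac_rel R a `` {(f, s)}"

definition localization :: "('a, 'm) ring_scheme \<Rightarrow> 'a \<Rightarrow> ('a \<times> nat) set ring" where
  "localization R a =
     \<lparr>carrier = (carrier R \<times> UNIV) // frac_rel R a,
      mult = (\<lambda>x y. \<Union>(f, s)\<in>x. \<Union>(g, t)\<in>y. fraction R a (f \<otimes>\<^bsub>R\<^esub> g) (s + t)),
      one = fraction R a \<one>\<^bsub>R\<^esub> 0,
      zero = fraction R a \<zero>\<^bsub>R\<^esub> 0,
      add = (\<lambda>x y. \<Union>(f, s)\<in>x. \<Union>(g, t)\<in>y.
               fraction R a (a [^]\<^bsub>R\<^esub> t \<otimes>\<^bsub>R\<^esub> f \<oplus>\<^bsub>R\<^esub> a [^]\<^bsub>R\<^esub> s \<otimes>\<^bsub>R\<^esub> g) (s + t))\<rparr>"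


section \<open>The fundamental invariant\<close>

text \<open>
  \<open>SL\<close>-invariant functions in the coordinate ring of the closed \<open>GL\<close>-stable cone \<open>X\<close> that are
  homogeneous of degree \<open>d\<close> under scalar multiplication of forms.
\<close>

definition SL_invariants :: "'n::finite mpoly set \<Rightarrow> nat \<Rightarrow> ('n mpoly \<Rightarrow> complex) set" where
  "SL_invariants X d =
     {f \<in> carrier (coord_ring X).
        (\<forall>g\<in>SL. \<forall>v\<in>X. f (act g v) = f v) \<and>
        (\<forall>c. \<forall>v\<in>X. f (mconst c * v) = c ^ d * f v)}"

definition minimal_degree :: "nat \<Rightarrow> 'n::finite mpoly \<Rightarrow> nat" where
  "minimal_degree D w =
     (LEAST d. d > 0 \<and> SL_invariants (orbit_closure D w) d \<noteq> {\<zero>\<^bsub>coord_ring (orbit_closure D w)\<^esub>})"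

text \<open>
  A relation rather than a function of \<open>w\<close>: the degree and the value at \<open>w\<close> determine the invariant
  because the invariants of a given degree form a space of dimension at most one, on which evaluation
  at \<open>w\<close> is injective.
\<close>

definition fundamental_invariant ::
    "nat \<Rightarrow> 'n::finite mpoly \<Rightarrow> ('n mpoly \<Rightarrow> complex) \<Rightarrow> bool" where
  "fundamental_invariant D w \<Phi> \<longleftrightarrow>
     \<Phi> \<in> SL_invariants (orbit_closure D w) (minimal_degree D w) \<and> \<Phi> w = 1"

end

theory Submission
  imports Defs "HOL-Computational_Algebra.Fundamental_Theorem_Algebra"
begin

text \<open>
Write \<open>X\<close> for the closure of the \<open>GL\<close>-orbit of \<open>w\<close>, \<open>m\<close> for the number of variables, and \<open>e\<close>
for the minimal degree. Since every scalar is a \<open>D\<close>-th power, the orbit \<open>GL w\<close> is the cone over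
the closed set \<open>SL w\<close>: its elements are the \<open>c y\<close> with \<open>c \<noteq> 0\<close> and \<open>y \<in> SL w\<close>
(\<open>GL_orbit_as_cone\<close>), and \<open>\<Phi>\<close> takes the value \<open>c ^ e\<close> at \<open>c y\<close>. Hence \<open>\<Phi>\<close> has no zero on
the orbit.

For the converse one needs \<open>e > 0\<close>, that is, an \<open>SL\<close>-invariant of positive degree that does not
vanish at \<open>w\<close> (\<open>exists_SL_invariant_of_positive_degree\<close>). As \<open>SL w\<close> is closed and does not
contain \<open>0\<close>, some polynomial vanishes on \<open>SL w\<close> but not at \<open>0\<close>; averaging it over \<open>SL\<close> and
splitting the result into homogeneous parts yields the invariant. The average is elementary. It is
a finite combination of evaluations at matrices (\<open>invariant_functional\<close>): write \<open>det ^ k\<close> as a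
combination of powers of linear forms on matrices and pair with it in the inner product in which
the \<open>K\<close>-th power of a linear form represents evaluation. Invariance of \<open>det ^ k\<close> under \<open>SL\<close> makes
this functional invariant, and positivity of the inner product makes it nonzero on \<open>det ^ k\<close>.

Given \<open>e > 0\<close>, let \<open>v \<in> X\<close> with \<open>\<Phi> v \<noteq> 0\<close>; rescaling gives \<open>\<Phi> v = 1\<close>. The elements of the orbit
where \<open>\<Phi> = 1\<close> form the union of the finitely many translates of \<open>SL w\<close> by \<open>e\<close>-th roots of unity,
which is closed. A polynomial that vanishes there can be made homogeneous with the help of powers of
\<open>\<Phi>\<close>, after splitting it by degrees modulo \<open>e\<close>; the homogeneous polynomials so obtained
vanish on the whole cone \<open>GL w\<close>, hence at \<open>v\<close> (\<open>zero_on_level_set\<close>). So \<open>v\<close> lies in the orbit,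
and \<open>GL w\<close> is the principal open subset of \<open>X\<close> where \<open>\<Phi> \<noteq> 0\<close>.

The rest is the description of the regular functions on a principal open subset. The polynomials
\<open>h\<close> for which \<open>h f\<close> is polynomial on the orbit form an ideal whose zeros in \<open>X\<close> lie outside the
orbit, so by the Nullstellensatz it contains a power of \<open>\<Phi>\<close> (\<open>regular_function_as_quotient\<close>). Over
the uncountable field of complex numbers the Nullstellensatz has a short proof by counting
dimensions, which covers countably many variables (\<open>nullstellensatz_countable\<close>). Finally, fractions
with the same values on the orbit are equal in the localization because the orbit is dense in \<open>X\<close>
(\<open>localization_iso\<close>).
\<close>

section \<open>Substitution in polynomials\<close>

text \<open>
Ring homomorphisms out of the complex numbers. The two needed below are the identity, for evaluating
polynomials, and the embedding as constants, for substituting polynomials into polynomials.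
\<close>

definition scalar_hom :: "(complex \<Rightarrow> 'b::comm_semiring_1) \<Rightarrow> bool" where
  "scalar_hom c \<longleftrightarrow> c 0 = 0 \<and> c 1 = 1 \<and> (\<forall>a b. c (a + b) = c a + c b) \<and> (\<forall>a b. c (a * b) = c a * c b)"

lemma scalar_hom_id: "scalar_hom (\<lambda>a. a)"
  by (simp add: scalar_hom_def)

lemma mconst_0 [simp]: "mconst 0 = 0" and mconst_1 [simp]: "mconst 1 = 1"
  by (simp_all add: mconst_def)

lemma mconst_add: "mconst (a + b) = mconst a + mconst b"
  and mconst_mult: "mconst (a * b) = mconst a * mconst b"
  by (simp_all add: mconst_def single_add mult_single)

lemma mconst_minus: "mconst (- a) = - mconst a"
  by (simp add: mconst_def single_uminus)

lemma mconst_sum: "mconst (sum f A) = (\<Sum>i\<in>A. mconst (f i))"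
  by (induction A rule: infinite_finite_induct) (simp_all add: mconst_add)

lemma mconst_power: "mconst (a ^ n) = mconst a ^ n"
  by (induction n) (simp_all add: mconst_mult)

lemma scalar_hom_mconst: "scalar_hom mconst"
  by (simp add: scalar_hom_def mconst_add mconst_mult)

lemma lookup_mconst_mult [simp]: "Poly_Mapping.lookup (mconst c * p) k = c * Poly_Mapping.lookup p k"
proof -
  have "mconst c * p = (\<Sum>\<mu>\<in>Poly_Mapping.keys p. Poly_Mapping.single \<mu> (c * Poly_Mapping.lookup p \<mu>))"
    by (subst mpoly_eq_sum_single[of p, symmetric]) (simp add: mconst_def sum_distrib_left mult_single)
  then show ?thesis
    by (auto simp: lookup_sum lookup_single when_def in_keys_iff)
qed

lemma single_eq_mconst_mult: "Poly_Mapping.single \<mu> c = mconst c * Poly_Mapping.single \<mu> 1"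
  by (simp add: mconst_def mult_single)

lemma monom_value_mvar: "monom_value mvar \<mu> = Poly_Mapping.single \<mu> 1"
proof -
  have single: "Poly_Mapping.single (Poly_Mapping.single i 1) (1::complex) ^ k
      = Poly_Mapping.single (Poly_Mapping.single i k) 1" for i :: 'a and k
    by (induction k) (simp_all add: mult_single flip: single_add)
  have prod: "(\<Prod>i\<in>A. Poly_Mapping.single (f i) (1::complex)) = Poly_Mapping.single (\<Sum>i\<in>A. f i) 1"
    for f :: "'a \<Rightarrow> 'a \<Rightarrow>\<^sub>0 nat" and A
    by (induction A rule: infinite_finite_induct) (simp_all add: mult_single)
  have "(\<Sum>i\<in>Poly_Mapping.keys \<mu>. Poly_Mapping.single i (Poly_Mapping.lookup \<mu> i)) = \<mu>"
    by (rule poly_mapping_eqI) (auto simp: lookup_sum lookup_single when_def in_keys_iff)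
  then show ?thesis
    by (simp add: monom_value_def mvar_def single[unfolded One_nat_def] prod)
qed

lemma subst_superset:
  assumes "scalar_hom c" "finite A" "Poly_Mapping.keys p \<subseteq> A"
  shows "mpoly_subst c x p = (\<Sum>\<mu>\<in>A. c (Poly_Mapping.lookup p \<mu>) * monom_value x \<mu>)"
  unfolding mpoly_subst_def
  by (rule sum.mono_neutral_left) (use assms in \<open>auto simp: in_keys_iff scalar_hom_def\<close>)

lemma subst_add:
  assumes c: "scalar_hom c"
  shows "mpoly_subst c x (p + q) = mpoly_subst c x p + mpoly_subst c x q"
proof -
  let ?A = "Poly_Mapping.keys p \<union> Poly_Mapping.keys q"
  have add: "c (a + b) = c a + c b" for a b
    using c by (simp add: scalar_hom_def)
  show ?thesis
    by (simp add: subst_superset[OF c, of ?A] Poly_Mapping.keys_add lookup_add add distrib_right sum.distrib)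
qed

lemma subst_sum:
  assumes c: "scalar_hom c"
  shows "mpoly_subst c x (sum f A) = (\<Sum>a\<in>A. mpoly_subst c x (f a))"
  by (induction A rule: infinite_finite_induct) (simp_all add: subst_add[OF c])

lemma subst_single:
  assumes c: "scalar_hom c"
  shows "mpoly_subst c x (Poly_Mapping.single \<mu> a) = c a * monom_value x \<mu>"
  by (subst subst_superset[OF c, of "{\<mu>}"]) (auto split: if_splits)

lemma subst_mult:
  assumes c: "scalar_hom c"
  shows "mpoly_subst c x (p * q) = mpoly_subst c x p * mpoly_subst c x q"
proof -
  let ?s = "\<lambda>p \<mu>. Poly_Mapping.single \<mu> (Poly_Mapping.lookup p \<mu>)"
  have cm: "c (a * b) = c a * c b" for a b
    using c by (simp add: scalar_hom_def)
  have "p * q = (\<Sum>\<mu>\<in>Poly_Mapping.keys p. \<Sum>\<nu>\<in>Poly_Mapping.keys q. ?s p \<mu> * ?s q \<nu>)"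
    unfolding sum_product[symmetric] mpoly_eq_sum_single ..
  also have "mpoly_subst c x \<dots> = mpoly_subst c x p * mpoly_subst c x q"
    by (simp add: subst_sum[OF c] mult_single subst_single[OF c] monom_value_add cm
        mpoly_subst_def[of c x p] mpoly_subst_def[of c x q] sum_product mult_ac)
  finally show ?thesis .
qed

lemma subst_mconst: "scalar_hom c \<Longrightarrow> mpoly_subst c x (mconst a) = c a"
  by (simp add: mconst_def subst_single monom_value_def)

lemma subst_one: "scalar_hom c \<Longrightarrow> mpoly_subst c x 1 = 1"
  using subst_mconst[of c x 1] by (simp add: scalar_hom_def)

lemma subst_mvar: "scalar_hom c \<Longrightarrow> mpoly_subst c x (mvar i) = x i"
  by (simp add: mvar_def subst_single monom_value_def scalar_hom_def)

lemma monom_value_hom: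
  fixes h :: "'b::comm_semiring_1 \<Rightarrow> 'c::comm_semiring_1"
  assumes one: "h 1 = 1" and mult: "\<And>a b. h (a * b) = h a * h b"
  shows "h (monom_value x \<mu>) = monom_value (\<lambda>i. h (x i)) \<mu>"
proof -
  have pow: "h (a ^ n) = h a ^ n" for a n
    by (induction n) (simp_all add: one mult)
  have "h (\<Prod>i\<in>A. f i) = (\<Prod>i\<in>A. h (f i))" for f :: "'a \<Rightarrow> 'b" and A
    by (induction A rule: infinite_finite_induct) (simp_all add: one mult)
  then show ?thesis
    by (simp add: monom_value_def pow)
qed

lemma subst_hom:
  fixes h :: "'b::comm_semiring_1 \<Rightarrow> 'c::comm_semiring_1"
  assumes "h 0 = 0" "h 1 = 1" "\<And>a b. h (a + b) = h a + h b" "\<And>a b. h (a * b) = h a * h b"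
  shows "h (mpoly_subst c x p) = mpoly_subst (\<lambda>a. h (c a)) (\<lambda>i. h (x i)) p"
proof -
  have "h (\<Sum>i\<in>A. f i) = (\<Sum>i\<in>A. h (f i))" for f :: "('a \<Rightarrow>\<^sub>0 nat) \<Rightarrow> 'b" and A
    by (induction A rule: infinite_finite_induct) (simp_all add: assms)
  then show ?thesis
    by (simp add: mpoly_subst_def assms monom_value_hom)
qed

lemma poly_fun_eq: "poly_fun P v =
    (\<Sum>\<mu>\<in>Poly_Mapping.keys P. Poly_Mapping.lookup P \<mu> * monom_value (Poly_Mapping.lookup v) \<mu>)"
  by (simp add: poly_fun_def mpoly_subst_def)

lemma poly_fun_add: "poly_fun (P + Q) v = poly_fun P v + poly_fun Q v"
  by (simp add: poly_fun_def mpoly_subst_add)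

lemma poly_fun_mconst [simp]: "poly_fun (mconst c) v = c"
  by (simp add: poly_fun_def subst_mconst scalar_hom_id)

lemma poly_fun_0 [simp]: "poly_fun 0 v = 0"
  by (simp add: poly_fun_def)

lemma poly_fun_mvar [simp]: "poly_fun (mvar \<nu>) v = Poly_Mapping.lookup v \<nu>"
  by (simp add: poly_fun_def subst_mvar scalar_hom_id)

lemma poly_fun_power: "poly_fun (P ^ n) v = poly_fun P v ^ n"
  by (induction n) (simp_all add: poly_fun_mult)

text \<open>
The total degree is summed over the support because the coordinates on the space of forms are
indexed by an infinite type.
\<close>

definition mdeg :: "('v \<Rightarrow>\<^sub>0 nat) \<Rightarrow> nat" where
  "mdeg \<mu> = (\<Sum>i\<in>Poly_Mapping.keys \<mu>. Poly_Mapping.lookup \<mu> i)"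

lemma monom_value_scale:
  "monom_value (\<lambda>i. c * x i) \<mu> = c ^ mdeg \<mu> * monom_value x \<mu>"
  by (simp add: monom_value_def mdeg_def power_mult_distrib prod.distrib power_sum)

section \<open>Homogeneous polynomial functions on matrices\<close>

text \<open>
Homogeneous polynomial functions of the entries of a matrix, built one entry at a time; this makes
it enough, in an induction, to multiply by a single entry.
\<close>

inductive homog :: "nat \<Rightarrow> (complex ^ 'n ^ 'n \<Rightarrow> complex) \<Rightarrow> bool" where
  homog_zero: "homog K (\<lambda>_. 0)"
| homog_const: "homog 0 (\<lambda>_. c)"
| homog_coord: "homog K f \<Longrightarrow> homog (Suc K) (\<lambda>x. x $ i $ j * f x)"
| homog_add: "homog K f \<Longrightarrow> homog K g \<Longrightarrow> homog K (\<lambda>x. f x + g x)"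

lemma homog_scale: "homog K f \<Longrightarrow> homog K (\<lambda>x. c * f x)"
proof (induction rule: homog.induct)
  case (homog_coord K f i j)
  then show ?case using homog.homog_coord[OF homog_coord.IH, of i j] by (simp add: mult_ac)
next
  case (homog_add K f g)
  then show ?case using homog.homog_add[OF homog_add.IH] by (simp add: algebra_simps)
next
  case (homog_const d)
  show ?case using homog.homog_const[of "c * d"] by simp
next
  case (homog_zero K)
  show ?case using homog.homog_zero by simp
qed

lemma homog_sum: "(\<And>i. i \<in> A \<Longrightarrow> homog K (f i)) \<Longrightarrow> homog K (\<lambda>x. \<Sum>i\<in>A. f i x)"
  by (induction A rule: infinite_finite_induct) (auto intro: homog_zero homog_add)

lemma homog_mult: "homog K f \<Longrightarrow> homog L g \<Longrightarrow> homog (K + L) (\<lambda>x. f x * g x)"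
proof (induction rule: homog.induct)
  case (homog_coord K f i j)
  then show ?case using homog.homog_coord[of "K + L" "\<lambda>x. f x * g x" i j] by (simp add: mult.assoc)
next
  case (homog_add K f f')
  then show ?case using homog.homog_add[of "K + L"] by (simp add: algebra_simps)
next
  case (homog_const d)
  then show ?case using homog_scale[of L g d] by simp
next
  case (homog_zero K)
  show ?case using homog.homog_zero[of "K + L"] by simp
qed

lemma homog_entry: "homog (Suc 0) (\<lambda>x. x $ i $ j)"
  using homog_coord[OF homog_const[of 1], of i j] by simp

lemma homog_power: "homog K f \<Longrightarrow> homog (n * K) (\<lambda>x. f x ^ n)"
  by (induction n) (auto intro: homog_const[of 1] homog_mult)

lemma homog_prod:
  "(\<And>i. i \<in> A \<Longrightarrow> homog (d i) (f i)) \<Longrightarrow> homog (\<Sum>i\<in>A. d i) (\<lambda>x. \<Prod>i\<in>A. f i x)"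
  by (induction A rule: infinite_finite_induct) (auto intro: homog_const[of 1] homog_mult)

lemma homog_det: "homog CARD('n) (det :: complex ^ 'n ^ 'n \<Rightarrow> complex)"
proof -
  have "homog (\<Sum>i\<in>(UNIV :: 'n set). Suc 0) (\<lambda>x :: complex ^ 'n ^ 'n. \<Prod>i\<in>UNIV. x $ i $ p i)" for p
    by (rule homog_prod) (rule homog_entry)
  then have "homog CARD('n) (\<lambda>x :: complex ^ 'n ^ 'n. \<Prod>i\<in>UNIV. x $ i $ p i)" for p
    by simp
  then show ?thesis
    unfolding det_def[abs_def] by (intro homog_sum homog_scale)
qed

section \<open>Powers of linear forms span\<close>

text \<open>
Bilinear, without conjugation: every linear form on matrices is \<open>dot b\<close> for some \<open>b\<close>.
\<close>

definition dot :: "complex ^ 'n ^ 'n \<Rightarrow> complex ^ 'n ^ 'n \<Rightarrow> complex" where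
  "dot b x = (\<Sum>i\<in>UNIV. \<Sum>j\<in>UNIV. b $ i $ j * x $ i $ j)"

inductive powspan :: "nat \<Rightarrow> (complex ^ 'n ^ 'n \<Rightarrow> complex) \<Rightarrow> bool" for K where
  powspan_zero: "powspan K (\<lambda>_. 0)"
| powspan_step: "powspan K f \<Longrightarrow> powspan K (\<lambda>x. c * dot b x ^ K + f x)"

lemma powspan_add: "powspan K f \<Longrightarrow> powspan K g \<Longrightarrow> powspan K (\<lambda>x. f x + g x)"
proof (induction rule: powspan.induct)
  case (powspan_step f c b)
  then show ?case using powspan.powspan_step[of K "\<lambda>x. f x + g x" c b] by (simp add: add_ac)
qed simp

lemma powspan_scale: "powspan K f \<Longrightarrow> powspan K (\<lambda>x. c * f x)"
proof (induction rule: powspan.induct)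
  case (powspan_step f d b)
  then show ?case
    using powspan.powspan_step[of K "\<lambda>x. c * f x" "c * d" b] by (simp add: algebra_simps)
qed (simp add: powspan_zero)

lemma powspan_power: "powspan K (\<lambda>x. dot b x ^ K)"
  using powspan_step[OF powspan_zero, of K 1 b] by simp

text \<open>
If a polynomial in \<open>t\<close> with coefficients in a function space takes values in the subspace \<open>V\<close> for
all natural numbers \<open>t\<close>, then its coefficients lie in \<open>V\<close>. Writing \<open>p t\<close> for the value at \<open>t\<close>,
the combination \<open>p (2 * t) - 2 ^ n * p t\<close> kills the coefficient of degree \<open>n\<close> and multiplies
each lower one by a nonzero number, so that induction on the degree replaces the inversion of a
Vandermonde matrix.
\<close>

lemma coefficients_in_subspace:
  fixes V :: "('x \<Rightarrow> complex) \<Rightarrow> bool"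
  assumes add: "\<And>f g. V f \<Longrightarrow> V g \<Longrightarrow> V (\<lambda>x. f x + g x)"
    and scale: "\<And>f c. V f \<Longrightarrow> V (\<lambda>x. c * f x)"
    and "\<And>t::nat. V (\<lambda>x. \<Sum>i\<le>n. of_nat t ^ i * u i x)" and "i \<le> n"
  shows "V (u i)"
  using assms(3,4)
proof (induction n arbitrary: u i)
  case 0
  then show ?case using "0.prems"(1)[of 1] by simp
next
  case (Suc n)
  let ?p = "\<lambda>(t::nat) x. \<Sum>i\<le>Suc n. of_nat t ^ i * u i x"
  have low: "V (u i)" if "i \<le> n" for i
  proof -
    define r :: "nat \<Rightarrow> complex" where "r i = 2 ^ i - 2 ^ Suc n" for i
    have "V (\<lambda>x. \<Sum>i\<le>n. of_nat t ^ i * (r i * u i x))" for t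
    proof -
      have "V (\<lambda>x. ?p (2 * t) x + (- (2 ^ Suc n)) * ?p t x)"
        by (intro add scale Suc.prems)
      moreover have "?p (2 * t) x + (- (2 ^ Suc n)) * ?p t x = (\<Sum>i\<le>n. of_nat t ^ i * (r i * u i x))" for x
      proof -
        have "?p (2 * t) x + (- (2 ^ Suc n)) * ?p t x = (\<Sum>i\<le>Suc n. of_nat t ^ i * (r i * u i x))"
          unfolding sum_distrib_left sum.distrib[symmetric]
          by (rule sum.cong) (simp_all add: r_def power_mult_distrib algebra_simps)
        then show ?thesis by (simp add: r_def)
      qed
      ultimately show ?thesis by simp
    qed
    then have "V (\<lambda>x. r i * u i x)"
      using Suc.IH[of "\<lambda>i x. r i * u i x" i] that by blast
    then have "V (\<lambda>x. inverse (r i) * (r i * u i x))" by (rule scale)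
    moreover have "(2::complex) ^ i \<noteq> 2 ^ Suc n"
    proof
      assume "(2::complex) ^ i = 2 ^ Suc n"
      then have "of_nat (2 ^ i) = (of_nat (2 ^ Suc n) :: complex)" by simp
      then have "(2::nat) ^ i = 2 ^ Suc n" unfolding of_nat_eq_iff .
      then have "i = Suc n" by (rule power_inject_exp[THEN iffD1, rotated]) simp
      with that show False by simp
    qed
    then have "r i \<noteq> 0" by (simp add: r_def)
    ultimately show ?thesis by (simp flip: mult.assoc)
  qed
  show ?case
  proof (cases "i = Suc n")
    case False
    then show ?thesis using low Suc.prems by simp
  next
    case True
    have "V (\<lambda>x. \<Sum>i\<le>m. u i x)" if "m \<le> n" for m
      using that by (induction m) (auto intro: low add)
    from add[OF Suc.prems(1)[of 1] scale[OF this[of n], of "- 1"]]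
    show ?thesis by (simp add: True)
  qed
qed

text \<open>
Polarization: up to the factor \<open>Suc K\<close>, the product is the coefficient of \<open>t\<close> in the power
\<open>(dot b x + t * x $ i $ j) ^ Suc K\<close>.
\<close>

lemma powspan_entry_mult_power: "powspan (Suc K) (\<lambda>x. x $ i $ j * dot b x ^ K)"
proof -
  define E :: "complex ^ 'a ^ 'a" where "E = (\<chi> k l. if k = i \<and> l = j then 1 else 0)"
  have E: "dot E x = x $ i $ j" for x
  proof -
    have "dot E x = (\<Sum>k\<in>UNIV. if k = i then \<Sum>l\<in>UNIV. if l = j then x $ k $ l else 0 else 0)"
      unfolding dot_def E_def by (intro sum.cong refl) (auto simp: if_distrib[of "\<lambda>y. y * _"] cong: if_cong)
    then show ?thesis by simp
  qed
  have lin: "dot (b + of_nat t *\<^sub>R E) x = of_nat t * x $ i $ j + dot b x" for t x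
  proof -
    have "dot (b + of_nat t *\<^sub>R E) x = dot b x + of_nat t * dot E x"
      by (simp add: dot_def sum.distrib sum_distrib_left algebra_simps scaleR_conv_of_real[where 'a = complex])
    then show ?thesis by (simp add: E)
  qed
  define u where "u l x = of_nat (Suc K choose l) * (x $ i $ j ^ l * dot b x ^ (Suc K - l))" for l x
  have "powspan (Suc K) (\<lambda>x. \<Sum>l\<le>Suc K. of_nat t ^ l * u l x)" for t
  proof -
    have "(\<lambda>x. \<Sum>l\<le>Suc K. of_nat t ^ l * u l x) = (\<lambda>x. dot (b + of_nat t *\<^sub>R E) x ^ Suc K)"
      unfolding lin binomial_ring u_def
      by (intro ext sum.cong refl) (simp_all add: power_mult_distrib mult_ac)
    then show ?thesis by (simp only: powspan_power)
  qed
  then have "powspan (Suc K) (u 1)"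
    by (rule coefficients_in_subspace[where V = "powspan (Suc K)", rotated 2]) 
       (auto intro: powspan_add powspan_scale)
  from powspan_scale[OF this, of "inverse (of_nat (Suc K))"] show ?thesis
    by (simp add: u_def field_simps del: of_nat_Suc)
qed

lemma homog_imp_powspan: "homog K f \<Longrightarrow> powspan K f"
proof (induction rule: homog.induct)
  case (homog_coord K f i j)
  from homog_coord.IH show ?case
  proof (induction rule: powspan.induct)
    case (powspan_step f c b)
    then show ?case
      using powspan_add[OF powspan_scale[OF powspan_entry_mult_power[of K i j b], of c]]
      by (simp add: algebra_simps)
  qed (simp add: powspan_zero)
next
  case (homog_const c)
  show ?case using powspan_scale[OF powspan_power[of 0 0], of c] by simp
qed (simp_all add: powspan_zero powspan_add)

lemma powspan_obtain:
  assumes "powspan K f"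
  obtains n c b where "\<And>x. f x = (\<Sum>s<n::nat. c s * dot (b s) x ^ K)"
proof -
  have "\<exists>n c b. \<forall>x. f x = (\<Sum>s<n::nat. c s * dot (b s) x ^ K)"
    using assms
  proof (induction rule: powspan.induct)
    case powspan_zero
    show ?case by (rule exI[of _ 0]) simp
  next
    case (powspan_step f d e)
    then obtain n c b where f: "\<And>x. f x = (\<Sum>s<n::nat. c s * dot (b s) x ^ K)" by blast
    have "d * dot e x ^ K + f x = (\<Sum>s<Suc n. (c(n := d)) s * dot ((b(n := e)) s) x ^ K)" for x
      by (simp add: f)
    then show ?case by blast
  qed
  then show ?thesis using that by blast
qed

section \<open>An invariant functional\<close>

definition mcnj :: "complex ^ 'n ^ 'n \<Rightarrow> complex ^ 'n ^ 'n" where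
  "mcnj x = (\<chi> i j. cnj (x $ i $ j))"

lemma mcnj_mcnj [simp]: "mcnj (mcnj x) = x"
  by (simp add: mcnj_def vec_eq_iff)

lemma det_mcnj: "det (mcnj x) = cnj (det x)"
  by (simp add: det_def mcnj_def)

lemma cnj_dot: "cnj (dot b x) = dot (mcnj b) (mcnj x)"
  by (simp add: dot_def mcnj_def)

lemma dot_commute: "dot b x = dot x b"
  by (simp add: dot_def mult.commute)

text \<open>
Right multiplication by \<open>h\<close> and by its transpose are adjoint to each other.
\<close>

lemma dot_matrix_mult: "dot b (x ** h) = dot (b ** transpose h) x"
proof -
  have "dot b (x ** h) = (\<Sum>i\<in>UNIV. \<Sum>j\<in>UNIV. \<Sum>k\<in>UNIV. b $ i $ j * (x $ i $ k * h $ k $ j))"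
    by (simp add: dot_def matrix_matrix_mult_def sum_distrib_left)
  also have "\<dots> = (\<Sum>i\<in>UNIV. \<Sum>k\<in>UNIV. \<Sum>j\<in>UNIV. b $ i $ j * (x $ i $ k * h $ k $ j))"
    by (rule sum.cong[OF refl], rule sum.swap)
  also have "\<dots> = dot (b ** transpose h) x"
    by (simp add: dot_def matrix_matrix_mult_def sum_distrib_left sum_distrib_right transpose_def mult_ac)
  finally show ?thesis .
qed

text \<open>
The \<open>K\<close>-th power of the bilinear form is the bilinear form on the \<open>K\<close>-th tensor power: the
products over \<open>I\<close> are the coordinates of the tensor powers of \<open>b\<close> and \<open>x\<close>.
\<close>

lemma dot_power_expand:
  fixes b x :: "complex ^ 'n ^ 'n"
  shows "dot b x ^ K = (\<Sum>I\<in>Pi\<^sub>E {..<K} (\<lambda>_. UNIV :: ('n \<times> 'n) set).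
    (\<Prod>k<K. b $ fst (I k) $ snd (I k)) * (\<Prod>k<K. x $ fst (I k) $ snd (I k)))"
proof -
  have "dot b x = (\<Sum>p\<in>UNIV. b $ fst p $ snd p * x $ fst p $ snd p)"
    by (simp add: dot_def sum.cartesian_product UNIV_Times_UNIV case_prod_beta)
  then have "dot b x ^ K = (\<Prod>k<K. \<Sum>p\<in>UNIV. b $ fst p $ snd p * x $ fst p $ snd p)"
    by simp
  also have "\<dots> = (\<Sum>I\<in>Pi\<^sub>E {..<K} (\<lambda>_. UNIV :: ('n \<times> 'n) set).
      \<Prod>k<K. b $ fst (I k) $ snd (I k) * x $ fst (I k) $ snd (I k))"
    by (rule prod_sum_PiE) auto
  finally show ?thesis by (simp add: prod.distrib)
qed

text \<open>
This is the substitute for integration over a compact form of \<open>SL\<close>. Let \<open>K = k * m\<close> and let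
\<open>det ^ k\<close> be the combination of the powers \<open>dot (b s) ^ K\<close> with coefficients \<open>c s\<close>. The functional
has coefficients \<open>cnj (c s)\<close> at the points \<open>mcnj (b s)\<close>. It sends \<open>dot e ^ K\<close> to \<open>det e ^ k\<close>, so
it takes the same value on a power of a linear form and on its right translate by \<open>h\<close>, and these
powers span. On \<open>det ^ k\<close> itself the functional is a sum of squared absolute values,
one for each coordinate of the tensor that represents \<open>det ^ k\<close>.
\<close>

theorem invariant_functional:
  fixes k :: nat
  shows "\<exists>n c (a :: nat \<Rightarrow> complex ^ 'n ^ 'n).
    (\<forall>f h. homog (k * CARD('n)) f \<longrightarrow> det h = 1 \<longrightarrow>
       (\<Sum>s<n. c s * f (a s ** h)) = (\<Sum>s<n. c s * f (a s))) \<and>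
    (\<Sum>s<n. c s * det (a s) ^ k) \<noteq> 0"
proof -
  let ?K = "k * CARD('n)"
  obtain n c and b :: "nat \<Rightarrow> complex ^ 'n ^ 'n"
    where det: "\<And>x. det x ^ k = (\<Sum>s<n. c s * dot (b s) x ^ ?K)"
    using powspan_obtain[OF homog_imp_powspan[OF homog_power[OF homog_det, of k]]] by metis
  have pow: "(\<Sum>s<n. cnj (c s) * dot e (mcnj (b s)) ^ ?K) = det e ^ k" for e
  proof -
    have "(\<Sum>s<n. cnj (c s) * dot e (mcnj (b s)) ^ ?K) = cnj (\<Sum>s<n. c s * dot (b s) (mcnj e) ^ ?K)"
      by (simp add: cnj_dot dot_commute)
    also have "\<dots> = det e ^ k"
      by (simp add: det_mcnj flip: det)
    finally show ?thesis .
  qed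
  have inv: "(\<Sum>s<n. cnj (c s) * f (mcnj (b s) ** h)) = (\<Sum>s<n. cnj (c s) * f (mcnj (b s)))"
    if "homog ?K f" and h: "det h = 1" for f h
    using homog_imp_powspan[OF that(1)]
  proof (induction rule: powspan.induct)
    case (powspan_step f d e)
    have "(\<Sum>s<n. cnj (c s) * (d * dot e (mcnj (b s) ** h) ^ ?K + f (mcnj (b s) ** h)))
        = d * (\<Sum>s<n. cnj (c s) * dot (e ** transpose h) (mcnj (b s)) ^ ?K)
          + (\<Sum>s<n. cnj (c s) * f (mcnj (b s) ** h))"
      by (simp add: dot_matrix_mult algebra_simps sum.distrib sum_distrib_left)
    also have "\<dots> = d * (\<Sum>s<n. cnj (c s) * dot e (mcnj (b s)) ^ ?K)
          + (\<Sum>s<n. cnj (c s) * f (mcnj (b s)))"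
      unfolding pow powspan_step.IH by (simp add: det_mul h)
    also have "\<dots> = (\<Sum>s<n. cnj (c s) * (d * dot e (mcnj (b s)) ^ ?K + f (mcnj (b s))))"
      by (simp add: algebra_simps sum.distrib sum_distrib_left)
    finally show ?case .
  qed simp
  let ?I = "Pi\<^sub>E {..<?K} (\<lambda>_. UNIV :: ('n \<times> 'n) set)"
  let ?m = "\<lambda>I x. \<Prod>k<?K. x $ fst (I k) $ snd (I k)"
  define S where "S I = (\<Sum>s<n. c s * ?m I (b s))" for I :: "nat \<Rightarrow> 'n \<times> 'n"
  have fin: "finite ?I" by (intro finite_PiE) auto
  have det': "det x ^ k = (\<Sum>I\<in>?I. S I * ?m I x)" for x
    unfolding det dot_power_expand S_def sum_distrib_left sum_distrib_right
    by (subst sum.swap) (simp add: mult_ac)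
  have m_mcnj: "?m I (mcnj x) = cnj (?m I x)" for I x
    by (simp add: mcnj_def)
  have "(\<Sum>s<n. cnj (c s) * det (mcnj (b s)) ^ k) = (\<Sum>I\<in>?I. S I * cnj (S I))"
    unfolding det' m_mcnj sum_distrib_left
    by (subst sum.swap) (simp add: S_def sum_distrib_left mult_ac)
  also have "\<dots> = of_real (\<Sum>I\<in>?I. (cmod (S I))\<^sup>2)"
    by (simp only: complex_norm_square[symmetric] of_real_sum)
  finally have sq: "(\<Sum>s<n. cnj (c s) * det (mcnj (b s)) ^ k) = of_real (\<Sum>I\<in>?I. (cmod (S I))\<^sup>2)" .
  have "(\<Sum>s<n. cnj (c s) * det (mcnj (b s)) ^ k) \<noteq> 0"
  proof
    assume "(\<Sum>s<n. cnj (c s) * det (mcnj (b s)) ^ k) = 0"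
    then have "(\<Sum>I\<in>?I. (cmod (S I))\<^sup>2) = 0" unfolding sq of_real_eq_0_iff .
    then have "\<forall>I\<in>?I. S I = 0"
      by (subst (asm) sum_nonneg_eq_0_iff[OF fin]) auto
    then have "det (mat 1 :: complex ^ 'n ^ 'n) ^ k = 0" unfolding det' by simp
    then show False by simp
  qed
  with inv show ?thesis
    by (intro exI[of _ n] exI[of _ "\<lambda>s. cnj (c s)"] exI[of _ "\<lambda>s. mcnj (b s)"]) blast
qed

section \<open>The action on forms\<close>

lemma mdeg_UNIV: "mdeg (\<mu> :: 'n::finite \<Rightarrow>\<^sub>0 nat) = (\<Sum>i\<in>UNIV. Poly_Mapping.lookup \<mu> i)"
  unfolding mdeg_def by (rule sum.mono_neutral_left) (auto simp: in_keys_iff)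

lemma mdeg_add: "mdeg (\<mu> + \<nu> :: 'n::finite \<Rightarrow>\<^sub>0 nat) = mdeg \<mu> + mdeg \<nu>"
  by (simp add: mdeg_UNIV lookup_add sum.distrib)

lemma mdeg_eq_0_iff: "mdeg \<mu> = 0 \<longleftrightarrow> \<mu> = 0"
proof
  assume "mdeg \<mu> = 0"
  then have "Poly_Mapping.lookup \<mu> i = 0" for i
    by (cases "i \<in> Poly_Mapping.keys \<mu>") (auto simp: mdeg_def in_keys_iff)
  then show "\<mu> = 0" by (intro poly_mapping_eqI) simp
qed (simp add: mdeg_def)

lemma forms_iff: "v \<in> forms D \<longleftrightarrow> (\<forall>\<mu>\<in>Poly_Mapping.keys v. mdeg \<mu> = D)"
  by (simp add: forms_def mdeg_UNIV)

lemma finite_monomials: "finite {\<mu> :: 'n::finite \<Rightarrow>\<^sub>0 nat. mdeg \<mu> = D}"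
proof -
  have "Poly_Mapping.lookup ` {\<mu> :: 'n \<Rightarrow>\<^sub>0 nat. mdeg \<mu> = D} \<subseteq> Pi\<^sub>E UNIV (\<lambda>_. {..D})"
    by (auto simp: mdeg_UNIV intro: member_le_sum)
  then have "finite (Poly_Mapping.lookup ` {\<mu> :: 'n \<Rightarrow>\<^sub>0 nat. mdeg \<mu> = D})"
    by (rule finite_subset) (intro finite_PiE, auto)
  then show ?thesis
    by (rule finite_imageD) (simp add: inj_on_def)
qed

lemma forms_0 [simp]: "0 \<in> forms D"
  by (simp add: forms_iff)

lemma forms_add: "v \<in> forms D \<Longrightarrow> v' \<in> forms D \<Longrightarrow> v + v' \<in> forms D"
  using Poly_Mapping.keys_add[of v v'] by (auto simp: forms_iff)

lemma forms_mconst_mult: "v \<in> forms D \<Longrightarrow> mconst c * v \<in> forms D"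
  by (auto simp: forms_iff in_keys_iff)

lemma lookup_form_0: "v \<in> forms D \<Longrightarrow> mdeg \<mu> \<noteq> D \<Longrightarrow> Poly_Mapping.lookup v \<mu> = 0"
  by (auto simp: forms_iff in_keys_iff)

lemma act_0 [simp]: "act g 0 = 0"
  and act_add: "act g (p + q) = act g p + act g q"
  and act_mult: "act g (p * q) = act g p * act g q"
  and act_sum: "act g (sum f A) = (\<Sum>i\<in>A. act g (f i))"
  and act_mconst [simp]: "act g (mconst c) = mconst c"
  and act_1 [simp]: "act g 1 = 1"
  by (simp_all add: act_def subst_add subst_mult subst_sum subst_mconst subst_one scalar_hom_mconst)

lemma act_mvar: "act g (mvar j) = (\<Sum>i\<in>UNIV. mconst (g $ i $ j) * mvar i)"
  by (simp add: act_def subst_mvar scalar_hom_mconst)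

lemma act_act: "act g (act h p) = act (g ** h) p"
proof -
  have "act g (act h p) = mpoly_subst mconst (\<lambda>j. act g (\<Sum>i\<in>UNIV. mconst (h $ i $ j) * mvar i)) p"
    unfolding act_def[of h] by (subst subst_hom[where h = "act g"]) (simp_all add: act_add act_mult)
  also have "(\<lambda>j. act g (\<Sum>i\<in>UNIV. mconst (h $ i $ j) * mvar i))
      = (\<lambda>j. \<Sum>i\<in>UNIV. mconst ((g ** h) $ i $ j) * mvar i)"
  proof
    fix j
    have "act g (\<Sum>k\<in>UNIV. mconst (h $ k $ j) * mvar k)
        = (\<Sum>k\<in>UNIV. \<Sum>i\<in>UNIV. mconst (g $ i $ k * h $ k $ j) * mvar i)"
      by (simp add: act_sum act_mult act_mvar sum_distrib_left mconst_mult mult_ac)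
    also have "\<dots> = (\<Sum>i\<in>UNIV. \<Sum>k\<in>UNIV. mconst (g $ i $ k * h $ k $ j) * mvar i)"
      by (rule sum.swap)
    finally show "act g (\<Sum>i\<in>UNIV. mconst (h $ i $ j) * mvar i)
        = (\<Sum>i\<in>UNIV. mconst ((g ** h) $ i $ j) * mvar i)"
      by (simp add: matrix_matrix_mult_def mconst_sum sum_distrib_right)
  qed
  finally show ?thesis by (simp add: act_def)
qed

lemma act_scalar_matrix:
  assumes "v \<in> forms D"
  shows "act (mat c) v = mconst (c ^ D) * v"
proof -
  have "(\<Sum>i\<in>UNIV. mconst (mat c $ i $ j) * mvar i) = mconst c * mvar j" for j :: 'a
  proof -
    have "(\<Sum>i\<in>UNIV. mconst (mat c $ i $ j) * mvar i) = (\<Sum>i\<in>UNIV. if i = j then mconst c * mvar i else 0)"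
      by (rule sum.cong) (auto simp: mat_def)
    then show ?thesis by simp
  qed
  then have "act (mat c) v = (\<Sum>\<mu>\<in>Poly_Mapping.keys v.
      mconst (Poly_Mapping.lookup v \<mu>) * (mconst c ^ mdeg \<mu> * Poly_Mapping.single \<mu> 1))"
    by (simp add: act_def mpoly_subst_def monom_value_scale monom_value_mvar)
  also have "\<dots> = (\<Sum>\<mu>\<in>Poly_Mapping.keys v. mconst (c ^ D) * Poly_Mapping.single \<mu> (Poly_Mapping.lookup v \<mu>))"
    by (rule sum.cong[OF refl], subst (2) single_eq_mconst_mult)
       (use assms in \<open>simp add: forms_iff mconst_power mult_ac\<close>)
  also have "\<dots> = mconst (c ^ D) * v"
    by (simp add: mpoly_eq_sum_single flip: sum_distrib_left)
  finally show ?thesis .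
qed

lemma act_mat_1 [simp]: "act (mat 1) v = v"
proof -
  have "(\<Sum>i\<in>UNIV. mconst (mat 1 $ i $ j) * mvar i) = (mvar j :: 'a mpoly)" for j :: 'a
  proof -
    have "(\<Sum>i\<in>UNIV. mconst (mat 1 $ i $ j) * mvar i) = (\<Sum>i\<in>UNIV. if i = j then mvar i else (0 :: 'a mpoly))"
      by (rule sum.cong) (auto simp: mat_def)
    then show ?thesis by simp
  qed
  then show ?thesis
    by (simp add: act_def mpoly_subst_def monom_value_mvar mpoly_eq_sum_single flip: single_eq_mconst_mult)
qed

text \<open>
Families of forms of degree \<open>d\<close> whose coefficients are homogeneous functions of degree \<open>K\<close> of a
matrix.
\<close>

inductive homog_form :: "nat \<Rightarrow> nat \<Rightarrow> (complex ^ 'n ^ 'n \<Rightarrow> 'n::finite mpoly) \<Rightarrow> bool" for d K where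
  homog_form_zero: "homog_form d K (\<lambda>_. 0)"
| homog_form_step: "homog_form d K F \<Longrightarrow> homog K f \<Longrightarrow> mdeg \<mu> = d \<Longrightarrow>
    homog_form d K (\<lambda>g. Poly_Mapping.single \<mu> (f g) + F g)"

lemma homog_form_single:
  "homog K f \<Longrightarrow> mdeg \<mu> = d \<Longrightarrow> homog_form d K (\<lambda>g. Poly_Mapping.single \<mu> (f g))"
  using homog_form_step[OF homog_form_zero, of K f \<mu> d] by simp

lemma homog_form_add:
  "homog_form d K F \<Longrightarrow> homog_form d K G \<Longrightarrow> homog_form d K (\<lambda>g. F g + G g)"
proof (induction rule: homog_form.induct)
  case (homog_form_step F f \<mu>)
  then show ?case
    using homog_form.homog_form_step[of d K "\<lambda>g. F g + G g" f \<mu>] by (simp add: add_ac)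
qed simp

lemma homog_form_sum:
  "(\<And>i. i \<in> A \<Longrightarrow> homog_form d K (F i)) \<Longrightarrow> homog_form d K (\<lambda>g. \<Sum>i\<in>A. F i g)"
  by (induction A rule: infinite_finite_induct) (auto intro: homog_form_zero homog_form_add)

lemma homog_form_mult:
  assumes "homog_form d K F" "homog_form e L G"
  shows "homog_form (d + e) (K + L) (\<lambda>g. F g * G g)"
  using assms(1)
proof (induction rule: homog_form.induct)
  case homog_form_zero
  show ?case by (simp add: homog_form.homog_form_zero)
next
  case (homog_form_step F f \<mu>)
  have "homog_form (d + e) (K + L) (\<lambda>g. Poly_Mapping.single \<mu> (f g) * G g)"
    using assms(2)
  proof (induction rule: homog_form.induct)
    case homog_form_zero
    show ?case by (simp add: homog_form.homog_form_zero)
  next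
    case (homog_form_step G h \<nu>)
    have "homog_form (d + e) (K + L) (\<lambda>g. Poly_Mapping.single (\<mu> + \<nu>) (f g * h g))"
      using homog_form_step \<open>homog K f\<close> \<open>mdeg \<mu> = d\<close>
      by (intro homog_form_single homog_mult) (simp_all add: mdeg_add)
    from homog_form_add[OF this homog_form_step.IH] show ?case
      by (simp add: distrib_left mult_single)
  qed
  from homog_form_add[OF this homog_form_step.IH] show ?case
    by (simp add: distrib_right)
qed

lemma homog_form_power:
  "homog_form d K F \<Longrightarrow> homog_form (n * d) (n * K) (\<lambda>g. F g ^ n)"
proof (induction n)
  case 0
  show ?case using homog_form_single[OF homog_const[of 1], of 0] by (simp add: mdeg_def)
next
  case (Suc n)
  then show ?case using homog_form_mult[of d K F "n * d" "n * K"] by simp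
qed

lemma homog_form_prod:
  "(\<And>i. i \<in> A \<Longrightarrow> homog_form (d i) (K i) (F i)) \<Longrightarrow>
    homog_form (\<Sum>i\<in>A. d i) (\<Sum>i\<in>A. K i) (\<lambda>g. \<Prod>i\<in>A. F i g)"
proof (induction A rule: infinite_finite_induct)
  case (insert i A)
  then show ?case using homog_form_mult[of "d i" "K i" "F i"] by simp
qed (use homog_form_single[OF homog_const[of 1], of 0] in \<open>simp_all add: mdeg_def\<close>)

lemma homog_form_imp_forms: "homog_form d K F \<Longrightarrow> F g \<in> forms d"
proof (induction rule: homog_form.induct)
  case (homog_form_step F f \<mu>)
  then have "Poly_Mapping.single \<mu> (f g) \<in> forms d" by (simp add: forms_iff)
  with homog_form_step.IH show ?case by (rule forms_add[rotated])
qed simp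

lemma homog_form_lookup: "homog_form d K F \<Longrightarrow> homog K (\<lambda>g. Poly_Mapping.lookup (F g) \<nu>)"
proof (induction rule: homog_form.induct)
  case (homog_form_step F f \<mu>)
  then show ?case
    by (cases "\<mu> = \<nu>") (auto simp: lookup_add lookup_single intro: homog_add)
qed (simp add: homog_zero)

text \<open>
Each variable is replaced by a linear form whose coefficients are entries of \<open>g\<close>, so a product of
\<open>D\<close> variables becomes a form of degree \<open>D\<close> with coefficients of degree \<open>D\<close> in \<open>g\<close>.
\<close>

lemma homog_form_act:
  assumes "v \<in> forms D"
  shows "homog_form D D (\<lambda>g. act g v)"
proof -
  have lin: "homog_form 1 1 (\<lambda>g. \<Sum>i\<in>UNIV. mconst (g $ i $ j) * mvar i)" for j :: 'a
  proof (rule homog_form_sum)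
    fix i :: 'a
    have "homog_form 1 1 (\<lambda>g. Poly_Mapping.single (Poly_Mapping.single i 1) (g $ i $ j))"
      by (rule homog_form_single[OF homog_entry[of i j, folded One_nat_def]]) (simp add: mdeg_def)
    moreover have "Poly_Mapping.single (Poly_Mapping.single i 1) c = mconst c * mvar i" for c
      by (simp add: mconst_def mvar_def mult_single)
    ultimately show "homog_form 1 1 (\<lambda>g. mconst (g $ i $ j) * mvar i)"
      by (simp only:)
  qed
  have "homog_form D D (\<lambda>g. mconst (Poly_Mapping.lookup v \<mu>)
      * monom_value (\<lambda>j. \<Sum>i\<in>UNIV. mconst (g $ i $ j) * mvar i) \<mu>)" if "\<mu> \<in> Poly_Mapping.keys v" for \<mu>
  proof -
    have "homog_form (\<Sum>i\<in>Poly_Mapping.keys \<mu>. Poly_Mapping.lookup \<mu> i * 1)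
        (\<Sum>i\<in>Poly_Mapping.keys \<mu>. Poly_Mapping.lookup \<mu> i * 1)
        (\<lambda>g. monom_value (\<lambda>j. \<Sum>i\<in>UNIV. mconst (g $ i $ j) * mvar i) \<mu>)"
      unfolding monom_value_def by (rule homog_form_prod, rule homog_form_power, rule lin)
    then have "homog_form D D (\<lambda>g. monom_value (\<lambda>j. \<Sum>i\<in>UNIV. mconst (g $ i $ j) * mvar i) \<mu>)"
      using that assms by (simp add: forms_iff mdeg_def)
    moreover have "homog_form 0 0 (\<lambda>_. mconst (Poly_Mapping.lookup v \<mu>))"
      unfolding mconst_def by (rule homog_form_single[OF homog_const]) (simp add: mdeg_def)
    ultimately show ?thesis using homog_form_mult[of 0 0 _ D D] by simp
  qed
  then show ?thesis
    unfolding act_def mpoly_subst_def by (rule homog_form_sum)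
qed

lemmas act_forms = homog_form_imp_forms[OF homog_form_act]
lemmas homog_lookup_act = homog_form_lookup[OF homog_form_act]

lemma homog_monom_value_act:
  assumes "v \<in> forms D"
  shows "homog (mdeg \<kappa> * D) (\<lambda>g. monom_value (Poly_Mapping.lookup (act g v)) \<kappa>)"
  unfolding monom_value_def mdeg_def sum_distrib_right
  by (rule homog_prod, rule homog_power, rule homog_lookup_act[OF assms])

section \<open>Polynomial functions on forms\<close>

text \<open>
Polynomial functions on the space of forms of degree \<open>D\<close>, where finitely many coordinates suffice.
The predicate makes closure properties available without writing down the polynomials.
\<close>

definition polyfn :: "nat \<Rightarrow> ('n::finite mpoly \<Rightarrow> complex) \<Rightarrow> bool" where
  "polyfn D f \<longleftrightarrow> (\<exists>P. \<forall>v\<in>forms D. poly_fun P v = f v)"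

lemma polyfn_const: "polyfn D (\<lambda>_. c)"
  unfolding polyfn_def by (rule exI[of _ "mconst c"]) simp

lemma polyfn_lookup: "polyfn D (\<lambda>v. Poly_Mapping.lookup v \<mu>)"
  unfolding polyfn_def by (rule exI[of _ "mvar \<mu>"]) simp

lemma polyfn_poly_fun: "polyfn D (poly_fun P)"
  unfolding polyfn_def by blast

lemma polyfn_add: 
  assumes "polyfn D f" "polyfn D g" shows "polyfn D (\<lambda>v. f v + g v)"
proof -
  obtain P Q where "\<forall>v\<in>forms D. poly_fun P v = f v" "\<forall>v\<in>forms D. poly_fun Q v = g v"
    using assms unfolding polyfn_def by blast
  then show ?thesis
    unfolding polyfn_def by (intro exI[of _ "P + Q"]) (simp add: poly_fun_add)
qed

lemma polyfn_mult: 
  assumes "polyfn D f" "polyfn D g" shows "polyfn D (\<lambda>v. f v * g v)"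
proof -
  obtain P Q where "\<forall>v\<in>forms D. poly_fun P v = f v" "\<forall>v\<in>forms D. poly_fun Q v = g v"
    using assms unfolding polyfn_def by blast
  then show ?thesis
    unfolding polyfn_def by (intro exI[of _ "P * Q"]) (simp add: poly_fun_mult)
qed

lemma polyfn_sum: "(\<And>i. i \<in> A \<Longrightarrow> polyfn D (f i)) \<Longrightarrow> polyfn D (\<lambda>v. \<Sum>i\<in>A. f i v)"
  by (induction A rule: infinite_finite_induct) (auto intro: polyfn_const polyfn_add)

lemma polyfn_prod: "(\<And>i. i \<in> A \<Longrightarrow> polyfn D (f i)) \<Longrightarrow> polyfn D (\<lambda>v. \<Prod>i\<in>A. f i v)"
  by (induction A rule: infinite_finite_induct) (auto intro: polyfn_const polyfn_mult)

lemma polyfn_power: "polyfn D f \<Longrightarrow> polyfn D (\<lambda>v. f v ^ n)"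
  by (induction n) (auto intro: polyfn_const polyfn_mult)

lemma polyfn_lookup_act: "polyfn D (\<lambda>v. Poly_Mapping.lookup (act g v) \<nu>)"
proof -
  let ?M = "{\<mu>. mdeg \<mu> = D}"
  have eq: "(\<Sum>\<mu>\<in>?M. Poly_Mapping.lookup v \<mu> * Poly_Mapping.lookup (act g (Poly_Mapping.single \<mu> 1)) \<nu>)
      = Poly_Mapping.lookup (act g v) \<nu>" if "v \<in> forms D" for v :: "'a mpoly"
  proof -
    have "(\<Sum>\<mu>\<in>?M. Poly_Mapping.single \<mu> (Poly_Mapping.lookup v \<mu>)) = v"
      by (rule poly_mapping_eqI)
         (use lookup_form_0[OF that] in \<open>auto simp: lookup_sum lookup_single when_def finite_monomials\<close>)
    then have "act g v = (\<Sum>\<mu>\<in>?M. act g (Poly_Mapping.single \<mu> (Poly_Mapping.lookup v \<mu>)))"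
      by (simp flip: act_sum)
    also have "\<dots> = (\<Sum>\<mu>\<in>?M. mconst (Poly_Mapping.lookup v \<mu>) * act g (Poly_Mapping.single \<mu> 1))"
      by (subst single_eq_mconst_mult) (simp add: act_mult)
    finally show ?thesis by (simp add: lookup_sum)
  qed
  have "polyfn D (\<lambda>v. \<Sum>\<mu>\<in>?M. Poly_Mapping.lookup v \<mu> * Poly_Mapping.lookup (act g (Poly_Mapping.single \<mu> 1)) \<nu>)"
    by (intro polyfn_sum polyfn_mult polyfn_lookup polyfn_const)
  then show ?thesis by (simp add: polyfn_def eq)
qed

lemma polyfn_monom_value_act: "polyfn D (\<lambda>v. monom_value (Poly_Mapping.lookup (act g v)) \<kappa>)"
  unfolding monom_value_def by (intro polyfn_prod polyfn_power polyfn_lookup_act)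

lemma polyfn_poly_fun_act: "polyfn D (\<lambda>v. poly_fun P (act g v))"
  unfolding poly_fun_eq by (intro polyfn_sum polyfn_mult polyfn_const polyfn_monom_value_act)

section \<open>Orbits\<close>

lemma mat_mult_mat: "mat a ** mat b = (mat (a * b) :: complex ^ 'n ^ 'n)"
proof -
  have "(\<Sum>k\<in>UNIV. mat a $ i $ k * mat b $ k $ j) = (mat (a * b) :: complex ^ 'n ^ 'n) $ i $ j" for i j :: 'n
  proof -
    have "(\<Sum>k\<in>UNIV. mat a $ i $ k * mat b $ k $ j) = (\<Sum>k\<in>UNIV. if k = i then a * mat b $ i $ j else 0)"
      by (rule sum.cong) (auto simp: mat_def)
    then show ?thesis by (simp add: mat_def)
  qed
  then show ?thesis by (simp add: vec_eq_iff matrix_matrix_mult_def)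
qed

lemma det_scalar_matrix: "det (mat c :: complex ^ 'n ^ 'n) = c ^ CARD('n)"
  by (subst det_diagonal) (auto simp: mat_def)

lemma GL_iff: "g \<in> GL \<longleftrightarrow> det g \<noteq> 0"
  by (simp add: GL_def invertible_det_nz)

lemma SL_iff: "g \<in> SL \<longleftrightarrow> det g = 1"
  by (simp add: SL_def)

lemma GL_mult: "g \<in> GL \<Longrightarrow> h \<in> GL \<Longrightarrow> g ** h \<in> GL"
  by (simp add: GL_iff det_mul)

lemma GL_orbit_act: "v \<in> GL_orbit w \<Longrightarrow> g \<in> GL \<Longrightarrow> act g v \<in> GL_orbit w"
  by (auto simp: GL_orbit_def act_act intro!: imageI GL_mult)

lemma self_in_GL_orbit: "w \<in> GL_orbit w"
  unfolding GL_orbit_def by (rule image_eqI[of _ _ "mat 1"]) (simp_all add: GL_iff)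

lemma SL_orbit_subset_GL_orbit: "SL_orbit w \<subseteq> GL_orbit w"
  by (auto simp: SL_orbit_def GL_orbit_def GL_iff SL_iff)

lemma GL_orbit_forms: "w \<in> forms D \<Longrightarrow> GL_orbit w \<subseteq> forms D"
  by (auto simp: GL_orbit_def act_forms)

lemma act_eq_0_iff:
  assumes "g \<in> GL" shows "act g w = 0 \<longleftrightarrow> w = 0"
proof -
  obtain h where "h ** g = mat 1"
    using assms unfolding GL_def invertible_def by blast
  then have "act h (act g w) = w" by (simp add: act_act)
  then show ?thesis by (metis act_0)
qed

lemma act_mconst_mult: "act g (mconst c * v) = mconst c * act g v"
  by (simp add: act_mult)

lemma GL_orbit_scale:
  assumes "D \<ge> 1" "w \<in> forms D" "v \<in> GL_orbit w" "c \<noteq> 0"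
  shows "mconst c * v \<in> GL_orbit w"
proof -
  obtain b where b: "b \<noteq> 0" "c = b ^ D"
    using exists_complex_root_nonzero[of c D] assms by auto
  have "mconst c * v = act (mat b) v"
    using act_scalar_matrix[of v D b] GL_orbit_forms[OF assms(2)] assms(3) b by auto
  moreover have "mat b \<in> GL" using b by (simp add: GL_iff det_scalar_matrix)
  ultimately show ?thesis using GL_orbit_act[OF assms(3)] by simp
qed

text \<open>
Dividing \<open>g\<close> by an \<open>m\<close>-th root of its determinant gives a matrix of determinant one.
\<close>

lemma GL_decompose:
  fixes g :: "complex ^ 'n ^ 'n"
  assumes "g \<in> GL"
  obtains t h where "t \<noteq> 0" "t ^ CARD('n) = det g" "h \<in> SL" "g = mat t ** h"
proof -
  have "det g \<noteq> 0" using assms by (simp add: GL_iff)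
  then obtain t where t: "t \<noteq> 0" "det g = t ^ CARD('n)"
    using exists_complex_root_nonzero[of "det g" "CARD('n)"] by auto
  show ?thesis
  proof
    show "t \<noteq> 0" "t ^ CARD('n) = det g" using t by simp_all
    show "mat (inverse t) ** g \<in> SL"
      using t by (simp add: SL_iff det_mul det_scalar_matrix power_inverse)
    show "g = mat t ** (mat (inverse t) ** g)"
      using t by (simp add: matrix_mul_assoc mat_mult_mat)
  qed
qed

lemma GL_orbit_as_cone:
  assumes "w \<in> forms D" "v \<in> GL_orbit w"
  obtains c y where "c \<noteq> 0" "y \<in> SL_orbit w" "v = mconst c * y"
proof -
  obtain g where g: "g \<in> GL" "v = act g w" using assms(2) by (auto simp: GL_orbit_def)
  obtain t h where th: "t \<noteq> 0" "h \<in> SL" "g = mat t ** h" using GL_decompose[OF g(1)] by metis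
  have "v = act (mat t) (act h w)" by (simp add: g th act_act)
  also have "\<dots> = mconst (t ^ D) * act h w"
    by (rule act_scalar_matrix) (rule act_forms[OF assms(1)])
  finally show ?thesis
    by (rule that[rotated 2]) (use th in \<open>auto simp: SL_orbit_def\<close>)
qed

section \<open>Averaging over roots of unity\<close>

text \<open>
Discrete Fourier inversion: averaging \<open>\<zeta> ^ e a / \<zeta> ^ r\<close> over the \<open>n\<close>-th roots of unity \<open>\<zeta>\<close>
selects the indices \<open>a\<close> with \<open>e a\<close> congruent to \<open>r\<close>.
\<close>

lemma roots_of_unity_filter:
  fixes c :: "'a \<Rightarrow> complex" and e :: "'a \<Rightarrow> nat"
  assumes n: "n \<ge> 1" and fin: "finite A"
    and zero: "\<And>\<zeta>. \<zeta> ^ n = 1 \<Longrightarrow> (\<Sum>a\<in>A. c a * \<zeta> ^ e a) = 0"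
  shows "(\<Sum>a\<in>{a \<in> A. e a mod n = r mod n}. c a) = 0"
proof -
  define \<omega> where "\<omega> j = exp (2 * of_real pi * \<i> * of_nat j / of_nat n)" for j
  have \<omega>_pow: "\<omega> j ^ k = \<omega> (j * k)" for j k
    by (simp add: \<omega>_def exp_of_nat_mult[symmetric] mult_ac)
  have \<omega>_n: "\<omega> j ^ n = 1" for j
    using complex_root_unity_eq_1[OF n, of "j * n"] by (simp only: \<omega>_pow) (simp add: \<omega>_def)
  have \<omega>_nz: "\<omega> j \<noteq> 0" for j by (simp add: \<omega>_def)
  have filter: "(\<Sum>j<n. \<omega> j ^ k / \<omega> j ^ r) = (if k mod n = r mod n then of_nat n else 0)" for k
  proof -
    have q: "\<omega> j ^ k / \<omega> j ^ r = (\<omega> k / \<omega> r) ^ j" for j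
      by (simp add: power_divide \<omega>_pow mult.commute)
    have eq: "\<omega> k / \<omega> r = 1 \<longleftrightarrow> k mod n = r mod n"
      using complex_root_unity_eq[OF n, of k r] \<omega>_nz[of r] by (simp add: \<omega>_def)
    show ?thesis
    proof (cases "k mod n = r mod n")
      case True
      then have "\<omega> k / \<omega> r = 1" using eq by blast
      then show ?thesis using True by (simp only: q) simp
    next
      case False
      define z where "z = \<omega> k / \<omega> r"
      have "z \<noteq> 1" using False unfolding z_def eq .
      moreover have "z ^ n = 1" by (simp add: z_def power_divide \<omega>_n)
      ultimately have "(\<Sum>j<n. z ^ j) = 0" by (simp add: geometric_sum)
      then show ?thesis using False by (simp add: q flip: z_def)
    qed
  qed
  have "(\<Sum>j<n. (\<Sum>a\<in>A. c a * \<omega> j ^ e a) / \<omega> j ^ r) = 0"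
    by (rule sum.neutral) (simp add: zero \<omega>_n)
  also have "(\<Sum>j<n. (\<Sum>a\<in>A. c a * \<omega> j ^ e a) / \<omega> j ^ r) = (\<Sum>a\<in>A. c a * (\<Sum>j<n. \<omega> j ^ e a / \<omega> j ^ r))"
    unfolding sum_divide_distrib sum_distrib_left by (subst sum.swap) simp
  also have "\<dots> = (\<Sum>a\<in>A. if e a mod n = r mod n then of_nat n * c a else 0)"
    unfolding filter by (rule sum.cong) auto
  also have "\<dots> = of_nat n * (\<Sum>a\<in>{a \<in> A. e a mod n = r mod n}. c a)"
    unfolding sum.inter_filter[OF fin] sum_distrib_left by (rule sum.cong) auto
  finally show ?thesis using n by simp
qed

section \<open>Existence of an invariant of positive degree\<close>

lemma polystable_separates_0:
  assumes "w \<noteq> 0" "polystable D w"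
  obtains P where "\<And>y. y \<in> SL_orbit w \<Longrightarrow> poly_fun P y = 0" "poly_fun P 0 \<noteq> 0"
proof -
  obtain I where I: "SL_orbit w = {v \<in> forms D. \<forall>P\<in>I. poly_fun P v = 0}"
    using assms(2) by (auto simp: polystable_def closedin_zariski)
  have "0 \<notin> SL_orbit w"
  proof
    assume "0 \<in> SL_orbit w"
    then obtain g where "g \<in> SL" "act g w = 0" by (auto simp: SL_orbit_def)
    then show False using act_eq_0_iff[of g w] assms(1) by (simp add: GL_iff SL_iff)
  qed
  then obtain P where "P \<in> I" "poly_fun P 0 \<noteq> 0" using I by auto
  moreover have "poly_fun P y = 0" if "y \<in> SL_orbit w" for y
    using that \<open>P \<in> I\<close> unfolding I by blast
  ultimately show ?thesis using that by blast
qed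

text \<open>
The scalar matrix \<open>\<zeta>\<close> has determinant one.
\<close>

lemma SL_orbit_scale_root:
  fixes w :: "'n::finite mpoly"
  assumes "w \<in> forms D" "y \<in> SL_orbit w" "\<zeta> ^ CARD('n) = 1"
  shows "mconst (\<zeta> ^ D) * y \<in> SL_orbit w"
proof -
  obtain g where g: "g \<in> SL" "y = act g w" using assms(2) by (auto simp: SL_orbit_def)
  have "mconst (\<zeta> ^ D) * y = act (mat \<zeta> ** g) w"
    using act_scalar_matrix[OF act_forms[OF assms(1)], of \<zeta> g] by (simp add: g act_act)
  moreover have "mat \<zeta> ** g \<in> SL" using g assms(3) by (simp add: SL_iff det_mul det_scalar_matrix)
  ultimately show ?thesis by (auto simp: SL_orbit_def)
qed

lemma monom_value_lookup_scale:
  "monom_value (Poly_Mapping.lookup (mconst c * v)) \<kappa> = c ^ mdeg \<kappa> * monom_value (Poly_Mapping.lookup v) \<kappa>"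
proof -
  have "Poly_Mapping.lookup (mconst c * v) = (\<lambda>i. c * Poly_Mapping.lookup v i)" by (rule ext) simp
  then show ?thesis by (simp add: monom_value_scale)
qed

text \<open>
Let \<open>P\<close> vanish on \<open>SL w\<close> but not at \<open>0\<close>. Because \<open>SL w\<close> is stable under scalar matrices of
determinant one, only the monomials \<open>\<kappa>\<close> for which \<open>m\<close> divides \<open>D * mdeg \<kappa>\<close> matter. For these,
\<open>e \<kappa>\<close> is the exponent with \<open>det g ^ e \<kappa> = t ^ (D * mdeg \<kappa>)\<close> whenever \<open>t ^ m = det g\<close>, so the
equation \<open>P (h w) = 0\<close>, with \<open>h\<close> in \<open>SL\<close> and \<open>g\<close> a multiple of \<open>h\<close>, becomes an identity between
homogeneous functions of degree \<open>k * m\<close> of \<open>g\<close>. Applying the invariant functional to the part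
of degree \<open>d\<close> in \<open>v\<close> gives an invariant \<open>F d\<close>. At \<open>w\<close> these values add up to zero, while the one
for \<open>d = 0\<close> is a nonzero multiple of the value on \<open>det ^ k\<close>; so another one is nonzero.
\<close>

theorem exists_SL_invariant_of_positive_degree:
  fixes w :: "'n::finite mpoly"
  assumes D: "D \<ge> 1" and w: "w \<in> forms D" "w \<noteq> 0" "polystable D w"
  obtains d F where "d > 0" "polyfn D F" "F w \<noteq> 0"
    "\<And>g v. g \<in> SL \<Longrightarrow> v \<in> forms D \<Longrightarrow> F (act g v) = F v"
    "\<And>c v. F (mconst c * v) = c ^ d * F v"
proof -
  let ?m = "CARD('n)"
  obtain P where P: "\<And>y. y \<in> SL_orbit w \<Longrightarrow> poly_fun P y = 0" and P0: "poly_fun P 0 \<noteq> 0"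
    using polystable_separates_0[OF w(2,3)] by metis
  let ?mv = "\<lambda>v. monom_value (Poly_Mapping.lookup v)"
  let ?c = "Poly_Mapping.lookup P"
  define A where "A = {\<kappa> \<in> Poly_Mapping.keys P. D * mdeg \<kappa> mod ?m = 0 mod ?m}"
  have finA: "finite A" by (simp add: A_def)
  have vanish: "(\<Sum>\<kappa>\<in>A. ?c \<kappa> * ?mv y \<kappa>) = 0" if y: "y \<in> SL_orbit w" for y
    unfolding A_def
  proof (rule roots_of_unity_filter)
    fix \<zeta> :: complex assume "\<zeta> ^ ?m = 1"
    then have "poly_fun P (mconst (\<zeta> ^ D) * y) = 0"
      by (intro P SL_orbit_scale_root[OF w(1) y])
    then show "(\<Sum>\<kappa>\<in>Poly_Mapping.keys P. ?c \<kappa> * ?mv y \<kappa> * \<zeta> ^ (D * mdeg \<kappa>)) = 0"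
      unfolding poly_fun_eq monom_value_lookup_scale power_mult[symmetric] by (simp add: mult_ac)
  qed simp_all
  define e where "e \<kappa> = D * mdeg \<kappa> div ?m" for \<kappa> :: "('n \<Rightarrow>\<^sub>0 nat) \<Rightarrow>\<^sub>0 nat"
  \<comment> \<open>\<open>k\<close> exceeds every \<open>e \<kappa>\<close>, so each term below keeps a factor \<open>det g\<close> and the identity also holds for
    singular \<open>g\<close>.\<close>
  define k where "k = Suc (\<Sum>\<kappa>\<in>A. e \<kappa>)"
  have e: "e \<kappa> * ?m = D * mdeg \<kappa>" "e \<kappa> < k" if "\<kappa> \<in> A" for \<kappa>
  proof -
    show "e \<kappa> * ?m = D * mdeg \<kappa>" using that by (auto simp: e_def A_def)
    show "e \<kappa> < k" using member_le_sum[OF that, of e] finA by (simp add: k_def)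
  qed
  have det_vanish: "(\<Sum>\<kappa>\<in>A. ?c \<kappa> * (det g ^ (k - e \<kappa>) * ?mv (act g w) \<kappa>)) = 0" for g :: "complex ^ 'n ^ 'n"
  proof (cases "det g = 0")
    case True
    then show ?thesis using e(2) by (intro sum.neutral) (fastforce simp: power_0_left)
  next
    case False
    then obtain t h where t: "t \<noteq> 0" "t ^ ?m = det g" "h \<in> SL" "g = mat t ** h"
      using GL_decompose[of g] by (metis GL_iff)
    have gw: "act g w = mconst (t ^ D) * act h w"
      using act_scalar_matrix[OF act_forms[OF w(1)], of t h] by (simp add: t(4) act_act)
    have "?c \<kappa> * (det g ^ (k - e \<kappa>) * ?mv (act g w) \<kappa>) = t ^ (k * ?m) * (?c \<kappa> * ?mv (act h w) \<kappa>)"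
      if "\<kappa> \<in> A" for \<kappa>
    proof -
      have "det g ^ (k - e \<kappa>) * ?mv (act g w) \<kappa> = (t ^ (?m * (k - e \<kappa>)) * t ^ (e \<kappa> * ?m)) * ?mv (act h w) \<kappa>"
        unfolding gw monom_value_lookup_scale t(2)[symmetric] e(1)[OF that] by (simp add: power_mult)
      also have "t ^ (?m * (k - e \<kappa>)) * t ^ (e \<kappa> * ?m) = t ^ (?m * (k - e \<kappa>) + e \<kappa> * ?m)"
        by (simp only: power_add)
      also have "?m * (k - e \<kappa>) + e \<kappa> * ?m = k * ?m"
        using e(2)[OF that] by (simp add: mult.commute[of ?m] flip: add_mult_distrib)
      finally show ?thesis by simp
    qed
    then have "(\<Sum>\<kappa>\<in>A. ?c \<kappa> * (det g ^ (k - e \<kappa>) * ?mv (act g w) \<kappa>))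
        = t ^ (k * ?m) * (\<Sum>\<kappa>\<in>A. ?c \<kappa> * ?mv (act h w) \<kappa>)"
      unfolding sum_distrib_left by (rule sum.cong[OF refl])
    also have "(\<Sum>\<kappa>\<in>A. ?c \<kappa> * ?mv (act h w) \<kappa>) = 0"
      by (rule vanish) (use t(3) in \<open>auto simp: SL_orbit_def\<close>)
    finally show ?thesis by simp
  qed
  obtain n :: nat and b and a :: "nat \<Rightarrow> complex ^ 'n ^ 'n" where
    ba: "\<forall>f h. homog (k * ?m) f \<longrightarrow> det h = 1 \<longrightarrow>
       (\<Sum>s<n. b s * f (a s ** h)) = (\<Sum>s<n. b s * f (a s))"
    and nz: "(\<Sum>s<n. b s * det (a s) ^ k) \<noteq> 0"
    using invariant_functional[where 'n = 'n and k = k] by (elim exE conjE) (rule that)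
  note inv = ba[rule_format]
  define f where "f d v g = (\<Sum>\<kappa>\<in>{\<kappa>\<in>A. mdeg \<kappa> = d}. ?c \<kappa> * (det g ^ (k - e \<kappa>) * ?mv (act g v) \<kappa>))"
    for d v and g :: "complex ^ 'n ^ 'n"
  define F where "F d v = (\<Sum>s<n. b s * f d v (a s))" for d v
  have "(\<Sum>d\<in>mdeg ` A. F d w) = 0"
  proof -
    have "(\<Sum>d\<in>mdeg ` A. f d w g) = 0" for g
      unfolding f_def sum.group[OF finA finite_imageI[OF finA] subset_refl] by (rule det_vanish)
    moreover have "(\<Sum>d\<in>mdeg ` A. F d w) = (\<Sum>s<n. b s * (\<Sum>d\<in>mdeg ` A. f d w (a s)))"
      unfolding F_def sum_distrib_left by (rule sum.swap)
    ultimately show ?thesis by simp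
  qed
  moreover have zero: "0 \<in> A" "{\<kappa>\<in>A. mdeg \<kappa> = 0} = {0}" and c0: "?c 0 \<noteq> 0"
  proof -
    have "?mv (0 :: 'n mpoly) \<kappa> = (if \<kappa> = 0 then 1 else 0)" for \<kappa> :: "('n \<Rightarrow>\<^sub>0 nat) \<Rightarrow>\<^sub>0 nat"
      using mdeg_eq_0_iff[of \<kappa>] monom_value_lookup_scale[of 0 "0 :: 'n mpoly" \<kappa>]
      by (cases "\<kappa> = 0") (simp_all add: monom_value_def power_0_left)
    then have "poly_fun P 0 = (\<Sum>\<kappa>\<in>Poly_Mapping.keys P. if \<kappa> = 0 then ?c \<kappa> else 0)"
      unfolding poly_fun_eq by (intro sum.cong) auto
    then have "poly_fun P 0 = ?c 0" by (simp add: in_keys_iff)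
    with P0 show c0: "?c 0 \<noteq> 0" by simp
    show "0 \<in> A" using c0 by (simp add: A_def in_keys_iff mdeg_def)
    then show "{\<kappa>\<in>A. mdeg \<kappa> = 0} = {0}" by (auto simp: mdeg_eq_0_iff)
  qed
  moreover have "F 0 w = ?c 0 * (\<Sum>s<n. b s * det (a s) ^ k)"
    unfolding F_def f_def zero(2)
    by (simp add: monom_value_def e_def mdeg_def sum_distrib_left mult_ac)
  then have "F 0 w \<noteq> 0" using nz c0 by simp
  ultimately obtain d where d: "d \<noteq> 0" "F d w \<noteq> 0"
  proof -
    have "(\<Sum>d\<in>mdeg ` A. F d w) = F 0 w + (\<Sum>d\<in>mdeg ` A - {0}. F d w)"
      by (rule sum.remove) (use finA zero in \<open>auto intro!: image_eqI[of _ _ 0] simp: mdeg_def\<close>)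
    with \<open>(\<Sum>d\<in>mdeg ` A. F d w) = 0\<close> \<open>F 0 w \<noteq> 0\<close> have "(\<Sum>d\<in>mdeg ` A - {0}. F d w) \<noteq> 0"
      by auto
    then obtain d where "d \<in> mdeg ` A - {0}" "F d w \<noteq> 0" by (rule sum.not_neutral_contains_not_neutral)
    then show ?thesis using that by blast
  qed
  show ?thesis
  proof
    show "d > 0" "F d w \<noteq> 0" using d by auto
    show "polyfn D (F d)"
      unfolding F_def f_def
      by (intro polyfn_sum polyfn_mult polyfn_const polyfn_monom_value_act)
    show "F d (mconst c * v) = c ^ d * F d v" for c v
      unfolding F_def f_def act_mconst_mult monom_value_lookup_scale sum_distrib_left
      by (intro sum.cong) (auto simp: mult_ac)
    fix g :: "complex ^ 'n ^ 'n" and v :: "'n mpoly" assume g: "g \<in> SL" and v: "v \<in> forms D"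
    have "homog (k * ?m) (\<lambda>x. det x ^ (k - e \<kappa>) * ?mv (act x v) \<kappa>)" if "\<kappa> \<in> A" for \<kappa>
    proof -
      have "(k - e \<kappa>) * ?m + mdeg \<kappa> * D = (k - e \<kappa> + e \<kappa>) * ?m"
        using e(1)[OF that] by (simp only: add_mult_distrib mult.commute[of _ D])
      then have "(k - e \<kappa>) * ?m + mdeg \<kappa> * D = k * ?m"
        using e(2)[OF that] by simp
      then show ?thesis
        using homog_mult[OF homog_power[OF homog_det] homog_monom_value_act[OF v, of \<kappa>], of "k - e \<kappa>"] by simp
    qed
    then have "homog (k * ?m) (f d v)"
      unfolding f_def by (intro homog_sum homog_scale) auto
    from inv[OF this] g have "(\<Sum>s<n. b s * f d v (a s ** g)) = F d v"
      by (simp add: SL_iff F_def)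
    moreover have "f d v (a s ** g) = f d (act g v) (a s)" for s
      using g by (simp add: f_def act_act det_mul SL_iff)
    ultimately show "F d (act g v) = F d v" by (simp add: F_def)
  qed
qed

section \<open>The orbit closure\<close>

lemma polyfn_eq:
  assumes "polyfn D f" obtains P where "\<And>v. v \<in> forms D \<Longrightarrow> poly_fun P v = f v"
  using assms unfolding polyfn_def by blast

lemma orbit_closure_iff:
  assumes w: "w \<in> forms D"
  shows "v \<in> orbit_closure D w \<longleftrightarrow>
    v \<in> forms D \<and> (\<forall>P. (\<forall>u\<in>GL_orbit w. poly_fun P u = 0) \<longrightarrow> poly_fun P v = 0)"
    (is "_ \<longleftrightarrow> _ \<and> (\<forall>P. ?vanish P \<longrightarrow> _)")
proof
  assume v: "v \<in> orbit_closure D w"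
  have "poly_fun P v = 0" if P: "?vanish P" for P
  proof (rule ccontr)
    assume "poly_fun P v \<noteq> 0"
    moreover have "openin (zariski D) {v \<in> forms D. poly_fun P v \<noteq> 0}"
      unfolding openin_zariski by (rule exI[of _ "{P}"]) simp
    moreover have "\<forall>T. v \<in> T \<and> openin (zariski D) T \<longrightarrow> (\<exists>u. u \<in> GL_orbit w \<and> u \<in> T)" "v \<in> forms D"
      using v unfolding orbit_closure_def in_closure_of by simp_all
    ultimately obtain u where "u \<in> GL_orbit w" "u \<in> {v \<in> forms D. poly_fun P v \<noteq> 0}"
      by (metis (mono_tags, lifting) mem_Collect_eq)
    with P show False by blast
  qed
  then show "v \<in> forms D \<and> (\<forall>P. ?vanish P \<longrightarrow> poly_fun P v = 0)"
    using v by (auto simp: orbit_closure_def in_closure_of)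
next
  assume v: "v \<in> forms D \<and> (\<forall>P. ?vanish P \<longrightarrow> poly_fun P v = 0)"
  show "v \<in> orbit_closure D w"
    unfolding orbit_closure_def in_closure_of
  proof (intro conjI allI impI)
    show "v \<in> topspace (zariski D)" using v by simp
    fix T assume T: "v \<in> T \<and> openin (zariski D) T"
    then obtain I where I: "T = {v \<in> forms D. \<exists>P\<in>I. poly_fun P v \<noteq> 0}"
      by (auto simp: openin_zariski)
    then obtain P where "P \<in> I" "poly_fun P v \<noteq> 0" using T by blast
    then obtain u where "u \<in> GL_orbit w" "poly_fun P u \<noteq> 0" using v by blast
    moreover have "u \<in> forms D" using \<open>u \<in> GL_orbit w\<close> GL_orbit_forms[OF w] by blast
    ultimately show "\<exists>u. u \<in> GL_orbit w \<and> u \<in> T" using I \<open>P \<in> I\<close> by blast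
  qed
qed

lemma orbit_closure_forms: "w \<in> forms D \<Longrightarrow> v \<in> orbit_closure D w \<Longrightarrow> v \<in> forms D"
  by (simp add: orbit_closure_iff)

lemma GL_orbit_subset_closure: "w \<in> forms D \<Longrightarrow> GL_orbit w \<subseteq> orbit_closure D w"
  using GL_orbit_forms[of w D] by (auto simp: orbit_closure_iff)

lemma polyfn_zero_on_closure:
  assumes "w \<in> forms D" "polyfn D f" "\<And>u. u \<in> GL_orbit w \<Longrightarrow> f u = 0" "v \<in> orbit_closure D w"
  shows "f v = 0"
proof -
  obtain P where P: "\<And>v. v \<in> forms D \<Longrightarrow> poly_fun P v = f v" using polyfn_eq[OF assms(2)] by blast
  then have "\<forall>u\<in>GL_orbit w. poly_fun P u = 0" using assms(3) GL_orbit_forms[OF assms(1)] by auto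
  then have "poly_fun P v = 0" using assms(1,4) orbit_closure_iff by blast
  with P show ?thesis using orbit_closure_forms[OF assms(1,4)] by simp
qed

lemma orbit_closure_act:
  assumes w: "w \<in> forms D" and "v \<in> orbit_closure D w" "g \<in> GL"
  shows "act g v \<in> orbit_closure D w"
  unfolding orbit_closure_iff[OF w]
proof (intro conjI allI impI)
  show "act g v \<in> forms D" using assms orbit_closure_forms act_forms by blast
  fix P assume P: "\<forall>u\<in>GL_orbit w. poly_fun P u = 0"
  show "poly_fun P (act g v) = 0"
    by (rule polyfn_zero_on_closure[OF w polyfn_poly_fun_act _ assms(2)])
       (use P GL_orbit_act assms(3) in blast)
qed

lemma poly_fun_scale: "poly_fun P (mconst c * v) =
    (\<Sum>\<kappa>\<in>Poly_Mapping.keys P. Poly_Mapping.lookup P \<kappa> * (c ^ mdeg \<kappa> * monom_value (Poly_Mapping.lookup v) \<kappa>))"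
  by (simp add: poly_fun_eq monom_value_lookup_scale)

lemma polyfn_poly_fun_scale: "polyfn D (\<lambda>v. poly_fun P (mconst c * v))"
  unfolding poly_fun_scale monom_value_def
  by (intro polyfn_sum polyfn_mult polyfn_const polyfn_prod polyfn_power polyfn_lookup)

text \<open>
For \<open>c \<noteq> 0\<close> the orbit itself is stable under scaling; the case \<open>c = 0\<close> follows by letting \<open>c\<close> tend
to zero.
\<close>

lemma orbit_closure_scale:
  assumes D: "D \<ge> 1" and w: "w \<in> forms D" and v: "v \<in> orbit_closure D w"
  shows "mconst c * v \<in> orbit_closure D w"
  unfolding orbit_closure_iff[OF w]
proof (intro conjI allI impI)
  show "mconst c * v \<in> forms D" by (intro forms_mconst_mult orbit_closure_forms[OF w v])
  fix P assume P: "\<forall>u\<in>GL_orbit w. poly_fun P u = 0"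
  have nz: "poly_fun P (mconst c * v) = 0" if "c \<noteq> 0" for c
    by (rule polyfn_zero_on_closure[OF w polyfn_poly_fun_scale _ v])
       (use P GL_orbit_scale[OF D w _ that] in blast)
  have "isCont (\<lambda>c. poly_fun P (mconst c * v)) 0"
    unfolding poly_fun_scale by (intro continuous_intros)
  then have "((\<lambda>c. poly_fun P (mconst c * v)) \<longlongrightarrow> poly_fun P (mconst 0 * v)) (at 0)"
    by (simp add: isCont_def)
  moreover have "((\<lambda>c. poly_fun P (mconst c * v)) \<longlongrightarrow> 0) (at 0)"
  proof (rule tendsto_eventually)
    show "\<forall>\<^sub>F c in at 0. poly_fun P (mconst c * v) = 0"
      unfolding eventually_at_filter by (simp add: nz)
  qed
  ultimately have "poly_fun P (mconst 0 * v) = 0" by (rule LIM_unique)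
  then show "poly_fun P (mconst c * v) = 0" using nz by (cases "c = 0") auto
qed

lemma SL_invariants_iff:
  "\<Phi> \<in> SL_invariants (orbit_closure D w) d \<longleftrightarrow>
    (\<exists>P. \<Phi> = restrict (poly_fun P) (orbit_closure D w)) \<and>
    (\<forall>g\<in>SL. \<forall>v\<in>orbit_closure D w. \<Phi> (act g v) = \<Phi> v) \<and>
    (\<forall>c. \<forall>v\<in>orbit_closure D w. \<Phi> (mconst c * v) = c ^ d * \<Phi> v)"
  by (auto simp: SL_invariants_def coord_ring_def fun_ring_def)

lemma minimal_degree_pos:
  assumes D: "D \<ge> 1" and w: "w \<in> forms D" "w \<noteq> 0" "polystable D w"
  shows "minimal_degree D w > 0"
proof -
  let ?X = "orbit_closure D w"
  obtain d F where d: "d > 0" and F: "polyfn D F" "F w \<noteq> 0"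
    and inv: "\<And>g v. g \<in> SL \<Longrightarrow> v \<in> forms D \<Longrightarrow> F (act g v) = F v"
    and hom: "\<And>c v. F (mconst c * v) = c ^ d * F v"
    using exists_SL_invariant_of_positive_degree[OF D w] by blast
  obtain P where P: "\<And>v. v \<in> forms D \<Longrightarrow> poly_fun P v = F v" using polyfn_eq[OF F(1)] by blast
  have eq: "restrict (poly_fun P) ?X = restrict F ?X"
    by (rule restrict_ext) (simp add: P orbit_closure_forms[OF w(1)])
  have "act g v \<in> ?X" if "g \<in> SL" "v \<in> ?X" for g v
    using orbit_closure_act[OF w(1) that(2), of g] that(1) by (simp add: GL_iff SL_iff)
  then have "restrict F ?X \<in> SL_invariants ?X d"
    unfolding SL_invariants_iff
    using eq by (auto intro!: exI[of _ P] simp: inv hom orbit_closure_forms[OF w(1)] orbit_closure_scale[OF D w(1)])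
  moreover have "w \<in> ?X" using GL_orbit_subset_closure[OF w(1)] self_in_GL_orbit by blast
  then have "restrict F ?X w \<noteq> \<zero>\<^bsub>coord_ring ?X\<^esub> w"
    using F(2) by (simp add: coord_ring_def fun_ring_def)
  then have "restrict F ?X \<noteq> \<zero>\<^bsub>coord_ring ?X\<^esub>" by metis
  ultimately have "d > 0 \<and> SL_invariants ?X d \<noteq> {\<zero>\<^bsub>coord_ring ?X\<^esub>}" using d by blast
  then show ?thesis unfolding minimal_degree_def by (rule LeastI2) simp
qed

section \<open>The boundary\<close>

lemma invariant_on_orbit:
  assumes w: "w \<in> forms D"
    and \<Phi>: "\<Phi> \<in> SL_invariants (orbit_closure D w) e" "\<Phi> w = 1"
    and y: "y \<in> SL_orbit w"
  shows "\<Phi> (mconst c * y) = c ^ e"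
proof -
  obtain g where g: "g \<in> SL" "y = act g w" using y by (auto simp: SL_orbit_def)
  have "w \<in> orbit_closure D w" "y \<in> orbit_closure D w"
    using GL_orbit_subset_closure[OF w] self_in_GL_orbit[of w] y SL_orbit_subset_GL_orbit by auto
  with g \<Phi> show ?thesis unfolding SL_invariants_iff by auto
qed

lemma invariant_nonzero_on_orbit:
  assumes w: "w \<in> forms D"
    and \<Phi>: "\<Phi> \<in> SL_invariants (orbit_closure D w) e" "\<Phi> w = 1" and v: "v \<in> GL_orbit w"
  shows "\<Phi> v \<noteq> 0"
proof -
  obtain c y where "c \<noteq> 0" "y \<in> SL_orbit w" "v = mconst c * y" by (rule GL_orbit_as_cone[OF w v])
  with invariant_on_orbit[OF w \<Phi>, of y c] show ?thesis by simp
qed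

text \<open>
Homogenization. Split \<open>P\<close> by degrees modulo \<open>e\<close>. Every part still vanishes on \<open>SL w\<close>, as the
hypothesis on \<open>P\<close> is stable under \<open>e\<close>-th roots of unity. Within one class the degrees differ by
multiples of \<open>e\<close>, so multiplication by powers of \<open>\<Phi>\<close> makes the part homogeneous without
changing its value where \<open>\<Phi> = 1\<close>. A homogeneous polynomial that vanishes on \<open>SL w\<close> vanishes on
the cone \<open>GL w\<close> and on its closure.
\<close>

lemma zero_on_level_set:
  assumes w: "w \<in> forms D"
    and \<Phi>: "\<Phi> \<in> SL_invariants (orbit_closure D w) e" "\<Phi> w = 1" and e: "e > 0"
    and P: "\<And>\<eta> y. \<eta> ^ e = 1 \<Longrightarrow> y \<in> SL_orbit w \<Longrightarrow> poly_fun P (mconst \<eta> * y) = 0"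
    and v: "v \<in> orbit_closure D w" "\<Phi> v = 1"
  shows "poly_fun P v = 0"
proof -
  let ?mv = "\<lambda>v. monom_value (Poly_Mapping.lookup v)"
  let ?c = "Poly_Mapping.lookup P"
  let ?K = "Poly_Mapping.keys P"
  obtain Q where Q: "\<Phi> = restrict (poly_fun Q) (orbit_closure D w)"
    using \<Phi>(1) unfolding SL_invariants_iff by blast
  have residue: "(\<Sum>\<kappa>\<in>{\<kappa>\<in>?K. mdeg \<kappa> mod e = r}. ?c \<kappa> * ?mv v \<kappa>) = 0" if r: "r < e" for r
  proof -
    define A where "A = {\<kappa>\<in>?K. mdeg \<kappa> mod e = r mod e}"
    have A: "A = {\<kappa>\<in>?K. mdeg \<kappa> mod e = r}" using r by (simp add: A_def)
    have finA: "finite A" by (simp add: A_def)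
    have on_SL: "(\<Sum>\<kappa>\<in>A. ?c \<kappa> * ?mv y \<kappa>) = 0" if y: "y \<in> SL_orbit w" for y
      unfolding A_def
    proof (rule roots_of_unity_filter)
      fix \<zeta> :: complex assume "\<zeta> ^ e = 1"
      then have "poly_fun P (mconst \<zeta> * y) = 0" using P y by blast
      then show "(\<Sum>\<kappa>\<in>?K. ?c \<kappa> * ?mv y \<kappa> * \<zeta> ^ mdeg \<kappa>) = 0"
        unfolding poly_fun_scale by (simp add: mult_ac)
    qed (use e in auto)
    \<comment> \<open>any upper bound of the quotients \<open>mdeg \<kappa> div e\<close> would do\<close>
    define M where "M = (\<Sum>\<kappa>\<in>A. mdeg \<kappa> div e)"
    have M: "mdeg \<kappa> + e * (M - mdeg \<kappa> div e) = r + e * M" if "\<kappa> \<in> A" for \<kappa>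
    proof -
      have "mdeg \<kappa> div e \<le> M" unfolding M_def by (rule member_le_sum) (use that finA in auto)
      then have "e * (mdeg \<kappa> div e) + e * (M - mdeg \<kappa> div e) = e * M"
        by (simp flip: add_mult_distrib2)
      moreover have "mdeg \<kappa> = r + e * (mdeg \<kappa> div e)"
        using that mod_mult_div_eq[of "mdeg \<kappa>" e] by (auto simp: A)
      ultimately show ?thesis by linarith
    qed
    define G where "G x = (\<Sum>\<kappa>\<in>A. ?c \<kappa> * ?mv x \<kappa> * poly_fun Q x ^ (M - mdeg \<kappa> div e))" for x :: "'a mpoly"
    have "G v = 0"
    proof (rule polyfn_zero_on_closure[OF w _ _ v(1)])
      show "polyfn D G"
        unfolding G_def monom_value_def
        by (intro polyfn_sum polyfn_mult polyfn_const polyfn_prod polyfn_power polyfn_lookup polyfn_poly_fun)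
      fix u assume u: "u \<in> GL_orbit w"
      then obtain c y where cy: "c \<noteq> 0" "y \<in> SL_orbit w" "u = mconst c * y"
        using GL_orbit_as_cone[OF w] by metis
      have "u \<in> orbit_closure D w" using u GL_orbit_subset_closure[OF w] by blast
      then have Qu: "poly_fun Q u = c ^ e"
        using invariant_on_orbit[OF w \<Phi> cy(2), of c] by (simp add: Q flip: cy(3))
      have "?c \<kappa> * ?mv u \<kappa> * poly_fun Q u ^ (M - mdeg \<kappa> div e) = c ^ (r + e * M) * (?c \<kappa> * ?mv y \<kappa>)"
        if "\<kappa> \<in> A" for \<kappa>
        unfolding Qu M[OF that, symmetric] power_add
        by (simp add: cy(3) monom_value_lookup_scale power_mult)
      then have "G u = c ^ (r + e * M) * (\<Sum>\<kappa>\<in>A. ?c \<kappa> * ?mv y \<kappa>)"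
        unfolding G_def sum_distrib_left by (rule sum.cong[OF refl])
      then show "G u = 0" using on_SL[OF cy(2)] by simp
    qed
    moreover have "poly_fun Q v = 1" using v by (simp add: Q)
    ultimately show ?thesis by (simp add: G_def A)
  qed
  have "poly_fun P v = (\<Sum>r<e. \<Sum>\<kappa>\<in>{\<kappa>\<in>?K. mdeg \<kappa> mod e = r}. ?c \<kappa> * ?mv v \<kappa>)"
    unfolding poly_fun_eq by (rule sum.group[symmetric]) (use e in auto)
  then show ?thesis by (simp add: residue)
qed

text \<open>
After rescaling to \<open>\<Phi> v = 1\<close>, suppose that no multiple of \<open>v\<close> by an \<open>e\<close>-th root of unity lies in
the closed set \<open>SL w\<close>. A product of polynomials separating these multiples from \<open>SL w\<close> then
contradicts \<open>zero_on_level_set\<close>.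
\<close>

theorem nonvanishing_imp_orbit:
  assumes D: "D \<ge> 1" and w: "w \<in> forms D" "polystable D w"
    and \<Phi>: "\<Phi> \<in> SL_invariants (orbit_closure D w) e" "\<Phi> w = 1" and e: "e > 0"
    and v: "v \<in> orbit_closure D w" "\<Phi> v \<noteq> 0"
  shows "v \<in> GL_orbit w"
proof -
  have "inverse (\<Phi> v) \<noteq> 0" "e \<noteq> 0" using e v(2) by simp_all
  then obtain c where c: "c \<noteq> 0" "inverse (\<Phi> v) = c ^ e"
    by (rule exists_complex_root_nonzero)
  let ?v = "mconst c * v"
  have v': "?v \<in> orbit_closure D w" by (rule orbit_closure_scale[OF D w(1) v(1)])
  have "\<Phi> ?v = 1" using \<Phi>(1) v c(2)[symmetric] unfolding SL_invariants_iff by simp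
  let ?R = "{\<zeta>::complex. \<zeta> ^ e = 1}"
  obtain I where I: "SL_orbit w = {v \<in> forms D. \<forall>P\<in>I. poly_fun P v = 0}"
    using w(2) by (auto simp: polystable_def closedin_zariski)
  have "\<exists>\<zeta>\<in>?R. mconst \<zeta> * ?v \<in> SL_orbit w"
  proof (rule ccontr)
    assume none: "\<not> ?thesis"
    have "\<forall>\<zeta>\<in>?R. \<exists>P. P \<in> I \<and> poly_fun P (mconst \<zeta> * ?v) \<noteq> 0"
      using none forms_mconst_mult[OF orbit_closure_forms[OF w(1) v']] unfolding I by blast
    then obtain p where p: "\<And>\<zeta>. \<zeta> \<in> ?R \<Longrightarrow> p \<zeta> \<in> I \<and> poly_fun (p \<zeta>) (mconst \<zeta> * ?v) \<noteq> 0"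
      by metis
    have "polyfn D (\<lambda>x. \<Prod>\<zeta>\<in>?R. poly_fun (p \<zeta>) (mconst \<zeta> * x))"
      by (intro polyfn_prod polyfn_poly_fun_scale)
    then obtain P where P: "\<And>x. x \<in> forms D \<Longrightarrow> poly_fun P x = (\<Prod>\<zeta>\<in>?R. poly_fun (p \<zeta>) (mconst \<zeta> * x))"
      using polyfn_eq by blast
    have fin: "finite ?R" using e by (intro finite_roots_unity) simp
    have "poly_fun P ?v = 0"
    proof (rule zero_on_level_set[OF w(1) \<Phi> e _ v' \<open>\<Phi> ?v = 1\<close>])
      fix \<eta> :: complex and y assume \<eta>: "\<eta> ^ e = 1" and y: "y \<in> SL_orbit w"
      have "\<eta> \<noteq> 0" using \<eta> e by (auto simp: power_0_left)
      have "mconst (inverse \<eta>) * (mconst \<eta> * y) = y"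
        using \<open>\<eta> \<noteq> 0\<close> by (simp flip: mult.assoc mconst_mult)
      moreover have "inverse \<eta> \<in> ?R" using \<eta> by (simp add: power_inverse)
      ultimately have "\<exists>\<zeta>\<in>?R. poly_fun (p \<zeta>) (mconst \<zeta> * (mconst \<eta> * y)) = 0"
        using p[of "inverse \<eta>"] y unfolding I by auto
      moreover have "mconst \<eta> * y \<in> forms D" using y by (intro forms_mconst_mult) (simp add: I)
      ultimately show "poly_fun P (mconst \<eta> * y) = 0"
        using fin by (simp add: P)
    qed
    moreover have "poly_fun P ?v \<noteq> 0"
      using fin p by (simp add: P orbit_closure_forms[OF w(1) v'])
    ultimately show False by contradiction
  qed
  then obtain \<zeta> where \<zeta>: "\<zeta> ^ e = 1" "mconst \<zeta> * ?v \<in> GL_orbit w"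
    using SL_orbit_subset_GL_orbit by blast
  have "\<zeta> \<noteq> 0" using \<zeta>(1) e by (auto simp: power_0_left)
  then have "mconst (inverse (\<zeta> * c)) * (mconst \<zeta> * ?v) \<in> GL_orbit w"
    using GL_orbit_scale[OF D w(1) \<zeta>(2)] c(1) by simp
  moreover have "mconst (inverse (\<zeta> * c)) * (mconst \<zeta> * ?v) = v"
  proof -
    have "inverse (\<zeta> * c) * \<zeta> * c = 1" using \<open>\<zeta> \<noteq> 0\<close> c(1) by (simp add: field_simps)
    moreover have "mconst (inverse (\<zeta> * c)) * (mconst \<zeta> * ?v) = mconst (inverse (\<zeta> * c) * \<zeta> * c) * v"
      by (simp only: mconst_mult mult.assoc)
    ultimately show ?thesis by simp
  qed
  ultimately show ?thesis by simp
qed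


section \<open>The Nullstellensatz in countably many variables\<close>

definition poly_ideal :: "'v mpoly set \<Rightarrow> bool" where
  "poly_ideal I \<longleftrightarrow> 0 \<in> I \<and> (\<forall>p\<in>I. \<forall>q\<in>I. p + q \<in> I) \<and> (\<forall>p\<in>I. \<forall>q. q * p \<in> I)"

lemma poly_idealD:
  assumes "poly_ideal I"
  shows poly_ideal_0: "0 \<in> I"
    and poly_ideal_add: "p \<in> I \<Longrightarrow> q \<in> I \<Longrightarrow> p + q \<in> I"
    and poly_ideal_mult: "p \<in> I \<Longrightarrow> q * p \<in> I"
    and poly_ideal_diff: "p \<in> I \<Longrightarrow> q \<in> I \<Longrightarrow> p - q \<in> I"
proof -
  show "0 \<in> I" and add: "p \<in> I \<Longrightarrow> q \<in> I \<Longrightarrow> p + q \<in> I" and mult: "p \<in> I \<Longrightarrow> q * p \<in> I" for p q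
    using assms by (auto simp: poly_ideal_def)
  show "p \<in> I \<Longrightarrow> q \<in> I \<Longrightarrow> p - q \<in> I"
    using add[of p "- 1 * q"] mult[of q "- 1"] by simp
qed

lemma poly_ideal_sum:
  assumes "poly_ideal I" "\<And>a. a \<in> A \<Longrightarrow> f a \<in> I"
  shows "sum f A \<in> I"
  using assms(2)
  by (induction A rule: infinite_finite_induct)
     (auto intro: poly_ideal_0[OF assms(1)] poly_ideal_add[OF assms(1)])

lemma poly_ideal_sup_principal:
  assumes "poly_ideal I"
  shows "poly_ideal {p + u * x | p u. p \<in> I}"
  unfolding poly_ideal_def
proof (intro conjI ballI allI)
  show "0 \<in> {p + u * x | p u. p \<in> I}"
    using poly_ideal_0[OF assms] by (auto intro!: exI[of _ 0])
next
  fix p q assume "p \<in> {p + u * x | p u. p \<in> I}" "q \<in> {p + u * x | p u. p \<in> I}"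
  then obtain p' u q' v where "p = p' + u * x" "q = q' + v * x" "p' \<in> I" "q' \<in> I"
    by auto
  then have "p + q = (p' + q') + (u + v) * x" "p' + q' \<in> I"
    by (simp_all add: algebra_simps poly_ideal_add[OF assms])
  then show "p + q \<in> {p + u * x | p u. p \<in> I}" by blast
next
  fix p q assume "p \<in> {p + u * x | p u. p \<in> I}"
  then obtain p' u where "p = p' + u * x" "p' \<in> I"
    by auto
  then have "q * p = q * p' + (q * u) * x" "q * p' \<in> I"
    using poly_ideal_mult[OF assms, of p' q] by (simp_all add: algebra_simps)
  then show "q * p \<in> {p + u * x | p u. p \<in> I}" by blast
qed

text \<open>
Ideals that are maximal with this property are prime. Working with them instead of maximal ideals gives the
strong form of the Nullstellensatz without an auxiliary variable.
\<close>

definition avoids_powers :: "'v mpoly \<Rightarrow> 'v mpoly set \<Rightarrow> bool" where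
  "avoids_powers h I \<longleftrightarrow> (\<forall>s::nat. h ^ s \<notin> I)"

lemma exists_maximal_avoiding_ideal:
  assumes "poly_ideal J" "avoids_powers h J"
  obtains M where "poly_ideal M" "avoids_powers h M" "J \<subseteq> M"
    and "\<And>I. poly_ideal I \<Longrightarrow> avoids_powers h I \<Longrightarrow> M \<subseteq> I \<Longrightarrow> I = M"
proof -
  let ?\<A> = "{I. poly_ideal I \<and> avoids_powers h I \<and> J \<subseteq> I}"
  have "\<exists>M\<in>?\<A>. \<forall>I\<in>?\<A>. M \<subseteq> I \<longrightarrow> I = M"
  proof (rule subset_Zorn_nonempty)
    show "?\<A> \<noteq> {}" using assms by blast
  next
    fix \<C> assume ne: "\<C> \<noteq> {}" and chain: "subset.chain ?\<A> \<C>"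
    have lin: "I \<subseteq> K \<or> K \<subseteq> I" if "I \<in> \<C>" "K \<in> \<C>" for I K
      using chain that unfolding subset.chain_def by blast
    have sub: "\<C> \<subseteq> ?\<A>"
      using chain by (auto simp: subset.chain_def)
    have "poly_ideal (\<Union>\<C>)"
      unfolding poly_ideal_def
    proof (intro conjI ballI allI)
      show "0 \<in> \<Union>\<C>" using ne sub poly_ideal_0 by blast
    next
      fix p q assume "p \<in> \<Union>\<C>" "q \<in> \<Union>\<C>"
      then obtain I K where IK: "I \<in> \<C>" "K \<in> \<C>" "p \<in> I" "q \<in> K" by blast
      then have "(p \<in> K \<and> q \<in> K) \<or> (p \<in> I \<and> q \<in> I)" using lin[of I K] by blast
      then show "p + q \<in> \<Union>\<C>" using IK sub poly_ideal_add by blast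
    next
      fix p q assume "p \<in> \<Union>\<C>"
      then show "q * p \<in> \<Union>\<C>" using sub poly_ideal_mult by blast
    qed
    moreover have "avoids_powers h (\<Union>\<C>)"
      using sub by (auto simp: avoids_powers_def)
    moreover have "J \<subseteq> \<Union>\<C>" using ne sub by blast
    ultimately show "\<Union>\<C> \<in> ?\<A>" by simp
  qed
  then obtain M where M: "poly_ideal M" "avoids_powers h M" "J \<subseteq> M"
    and max: "\<forall>I\<in>?\<A>. M \<subseteq> I \<longrightarrow> I = M" by auto
  show ?thesis
    by (rule that[OF M]) (use max M in auto)
qed

lemma countable_UNIV_poly_mapping_nat:
  assumes "countable (UNIV :: 'v set)"
  shows "countable (UNIV :: ('v \<Rightarrow>\<^sub>0 nat) set)"
proof -
  let ?graph = "\<lambda>f :: 'v \<Rightarrow>\<^sub>0 nat. (\<lambda>i. (i, Poly_Mapping.lookup f i)) ` Poly_Mapping.keys f"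
  have cnt: "countable (UNIV :: ('v \<times> nat) set)"
    using countable_SIGMA[OF assms, of "\<lambda>_. UNIV :: nat set"] by simp
  have "countable {S :: ('v \<times> nat) set. S \<subseteq> UNIV \<and> finite S}"
    using countable_Collect_finite_subset[OF cnt] by (simp add: conj_commute)
  then have "countable (range ?graph)"
    by (rule countable_subset[rotated]) auto
  moreover have "inj ?graph"
  proof (rule injI)
    fix f g assume eq: "?graph f = ?graph g"
    show "f = g"
    proof (rule poly_mapping_eqI)
      fix i
      have *: "(i, n) \<in> ?graph e \<longleftrightarrow> n \<noteq> 0 \<and> Poly_Mapping.lookup e i = n" for n e
        by (auto simp: in_keys_iff)
      have "(i, n) \<in> ?graph f \<longleftrightarrow> (i, n) \<in> ?graph g" for n
        using eq by simp
      then have "n \<noteq> 0 \<and> Poly_Mapping.lookup f i = n \<longleftrightarrow> n \<noteq> 0 \<and> Poly_Mapping.lookup g i = n" for n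
        unfolding * .
      from this[of "Poly_Mapping.lookup f i"] this[of "Poly_Mapping.lookup g i"]
      show "Poly_Mapping.lookup f i = Poly_Mapping.lookup g i"
        by fastforce
    qed
  qed
  ultimately show ?thesis
    using countable_image_inj_on by blast
qed

lemma uncountable_fibre:
  assumes "uncountable A" "countable (f ` A)"
  obtains y where "uncountable {a \<in> A. f a = y}"
proof -
  have eq: "(\<Union>y\<in>f ` A. {a \<in> A. f a = y}) = A" by auto
  have "\<exists>y. uncountable {a \<in> A. f a = y}"
  proof (rule ccontr)
    assume "\<not> ?thesis"
    then have "countable (\<Union>y\<in>f ` A. {a \<in> A. f a = y})"
      by (intro countable_UN assms(2)) simp
    with assms(1) show False unfolding eq by contradiction
  qed
  with that show ?thesis by blast
qed

interpretation mpoly_vs: vector_space "\<lambda>c (p :: 'v mpoly). mconst c * p"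
  by unfold_locales (simp_all add: mconst_add mconst_mult algebra_simps)

text \<open>
A polynomial ring in countably many variables has countably many monomials, hence countably many
finite sets of monomials. Uncountably many members of the family therefore have the same support,
and already finitely many of them exceed the dimension of the space of such polynomials.
\<close>

lemma uncountable_family_dependent:
  fixes u :: "complex \<Rightarrow> 'v mpoly"
  assumes cnt: "countable (UNIV :: 'v set)" and A: "uncountable A"
  obtains B c b where "finite B" "B \<subseteq> A" "b \<in> B" "c b \<noteq> 0" "(\<Sum>a\<in>B. mconst (c a) * u a) = 0"
proof -
  have "countable ((\<lambda>a. Poly_Mapping.keys (u a)) ` A)"
    using countable_Collect_finite_subset[OF countable_UNIV_poly_mapping_nat[OF cnt]]
    by (rule countable_subset[rotated]) auto
  then obtain K where "uncountable {a \<in> A. Poly_Mapping.keys (u a) = K}"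
    using uncountable_fibre[OF A] by blast
  then have inf: "infinite {a \<in> A. Poly_Mapping.keys (u a) = K}"
    using countable_finite by blast
  then obtain B where B: "B \<subseteq> {a \<in> A. Poly_Mapping.keys (u a) = K}" "finite B" "card B = Suc (card K)"
    using infinite_arbitrarily_large[OF inf, of "Suc (card K)"] by metis
  then obtain a0 where "a0 \<in> B" by fastforce
  then have K: "finite K" using B by auto
  show ?thesis
  proof (cases "inj_on u B")
    case False
    then obtain a b where ab: "a \<in> B" "b \<in> B" "a \<noteq> b" "u a = u b"
      by (auto simp: inj_on_def)
    show ?thesis
      by (rule that[of "{a, b}" a "\<lambda>x. if x = a then 1 else - 1"])
         (use ab B in \<open>auto simp: mconst_minus\<close>)
  next
    case True
    let ?S = "(\<lambda>\<mu>. Poly_Mapping.single \<mu> (1::complex)) ` K"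
    have "u ` B \<subseteq> mpoly_vs.span ?S"
    proof
      fix p assume "p \<in> u ` B"
      then have keys: "Poly_Mapping.keys p = K" using B by auto
      have "(\<Sum>\<mu>\<in>K. mconst (Poly_Mapping.lookup p \<mu>) * Poly_Mapping.single \<mu> 1) \<in> mpoly_vs.span ?S"
        by (intro mpoly_vs.span_sum mpoly_vs.span_scale mpoly_vs.span_base) auto
      moreover have "(\<Sum>\<mu>\<in>K. mconst (Poly_Mapping.lookup p \<mu>) * Poly_Mapping.single \<mu> 1) = p"
        using mpoly_eq_sum_single[of p] keys by (simp flip: single_eq_mconst_mult)
      ultimately show "p \<in> mpoly_vs.span ?S" by simp
    qed
    moreover have "\<not> card (u ` B) \<le> card ?S"
      using card_image[OF True] B(3) card_image_le[OF K, of "\<lambda>\<mu>. Poly_Mapping.single \<mu> (1::complex)"]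
      by simp
    ultimately have "mpoly_vs.dependent (u ` B)"
      using mpoly_vs.independent_span_bound[of ?S "u ` B"] K by blast
    then obtain c where c: "\<exists>p\<in>u ` B. c p \<noteq> 0" "(\<Sum>p\<in>u ` B. mconst (c p) * p) = 0"
      using mpoly_vs.dependent_finite[of "u ` B"] B(2) by auto
    then obtain b where b: "b \<in> B" "c (u b) \<noteq> 0" by blast
    show ?thesis
      by (rule that[of B b "\<lambda>a. c (u a)"]) (use b B c(2) True in \<open>auto simp: sum.reindex\<close>)
  qed
qed

definition uni_eval :: "complex poly \<Rightarrow> 'v mpoly \<Rightarrow> 'v mpoly" where
  "uni_eval q x = poly (map_poly mconst q) x"

lemma uni_eval_0 [simp]: "uni_eval 0 x = 0"
  and uni_eval_pCons [simp]: "uni_eval (pCons a q) x = mconst a + x * uni_eval q x"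
  by (simp_all add: uni_eval_def map_poly_pCons)

lemma uni_eval_add: "uni_eval (p + q) x = uni_eval p x + uni_eval q x"
proof -
  have "map_poly mconst (p + q) = map_poly mconst p + (map_poly mconst q :: 'a mpoly poly)"
    by (rule poly_eqI) (simp add: coeff_map_poly mconst_add)
  then show ?thesis by (simp add: uni_eval_def poly_add)
qed

lemma uni_eval_smult: "uni_eval (smult a q) x = mconst a * uni_eval q x"
  by (induction q) (simp_all add: mconst_mult algebra_simps)

lemma uni_eval_mult: "uni_eval (p * q) x = uni_eval p x * uni_eval q x"
  by (induction p) (simp_all add: uni_eval_add uni_eval_smult algebra_simps)

lemma uni_eval_sum: "uni_eval (sum f A) x = (\<Sum>a\<in>A. uni_eval (f a) x)"
  by (induction A rule: infinite_finite_induct) (simp_all add: uni_eval_add)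

lemma uni_eval_prod: "uni_eval (prod f A) x = (\<Prod>a\<in>A. uni_eval (f a) x)"
proof -
  have "uni_eval 1 x = 1" by (simp add: one_pCons)
  then show ?thesis
    by (induction A rule: infinite_finite_induct) (simp_all add: uni_eval_mult)
qed

text \<open>
Over an algebraically closed field the polynomial \<open>q\<close> splits into linear factors, and a prime ideal
contains one of the factors of any product in it.
\<close>

lemma prime_ideal_uni_eval:
  assumes M: "poly_ideal M" and one: "1 \<notin> M"
    and prime: "\<And>p q. p * q \<in> M \<Longrightarrow> p \<in> M \<or> q \<in> M"
    and "q \<noteq> 0" "uni_eval q x \<in> M"
  shows "\<exists>a. x - mconst a \<in> M"
  using assms(4,5)
proof (induction "degree q" arbitrary: q rule: less_induct)
  case less
  show ?case
  proof (cases "degree q = 0")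
    case True
    then obtain a where q: "q = [:a:]" by (rule degree_eq_zeroE)
    with less.prems have "mconst (1 / a) * mconst a \<in> M" "a \<noteq> 0"
      using poly_ideal_mult[OF M] by auto
    then have "1 \<in> M" by (simp flip: mconst_mult)
    with one show ?thesis by blast
  next
    case False
    then have "\<not> constant (poly q)" by (simp add: constant_degree)
    then obtain z where "poly q z = 0" using fundamental_theorem_of_algebra by blast
    then obtain r where r: "q = [:- z, 1:] * r" by (auto simp: poly_eq_0_iff_dvd)
    have "uni_eval q x = (x - mconst z) * uni_eval r x"
      unfolding r uni_eval_mult by (simp add: mconst_minus)
    then have "x - mconst z \<in> M \<or> uni_eval r x \<in> M"
      using prime less.prems by metis
    moreover have "r \<noteq> 0" using r less.prems by auto
    moreover have "degree r < degree q"
      using \<open>r \<noteq> 0\<close> by (simp add: r degree_mult_eq del: mult_pCons_left)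
    ultimately show ?thesis using less.hyps by blast
  qed
qed

text \<open>
Let \<open>M\<close> be maximal among the ideals that contain \<open>J\<close> but no power of \<open>h\<close>. It suffices to find, for
each variable \<open>i\<close>, a number \<open>a\<close> with \<open>mvar i - mconst a \<in> M\<close>: these numbers are the coordinates of
a point, and modulo \<open>M\<close> every polynomial is its value there. If there were no such \<open>a\<close>,
then for every \<open>a\<close> the maximality of \<open>M\<close> would give \<open>u a\<close> and an exponent \<open>s a\<close> with
\<open>h ^ s a \<equiv> u a * (mvar i - mconst a)\<close> modulo \<open>M\<close>. For uncountably many \<open>a\<close> the exponent is
the same number \<open>n\<close>, and a linear relation among the corresponding \<open>u a\<close>, after clearing
denominators, puts \<open>h ^ n\<close> times a nonzero polynomial in \<open>mvar i\<close> into \<open>M\<close>.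
\<close>

theorem nullstellensatz_countable:
  fixes J :: "'v mpoly set"
  assumes cnt: "countable (UNIV :: 'v set)"
    and J: "poly_ideal J" "avoids_powers h J"
  obtains x where "\<And>p. p \<in> J \<Longrightarrow> mpoly_subst (\<lambda>a. a) x p = 0" "mpoly_subst (\<lambda>a. a) x h \<noteq> 0"
proof -
  obtain M where M: "poly_ideal M" and avoid: "avoids_powers h M" and JM: "J \<subseteq> M"
    and max: "\<And>I. poly_ideal I \<Longrightarrow> avoids_powers h I \<Longrightarrow> M \<subseteq> I \<Longrightarrow> I = M"
    using exists_maximal_avoiding_ideal[OF J] by metis
  note add = poly_ideal_add[OF M] and mult = poly_ideal_mult[OF M] and diff = poly_ideal_diff[OF M]
  have one: "1 \<notin> M"
    using avoid power_0[of h] unfolding avoids_powers_def by metis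
  have inv: "\<exists>s u. h ^ s - u * p \<in> M" if "p \<notin> M" for p
  proof -
    let ?I = "{m + u * p | m u. m \<in> M}"
    have "p = 0 + 1 * p" by simp
    then have "p \<in> ?I" using poly_ideal_0[OF M] by blast
    moreover have "m = m + 0 * p" for m by simp
    then have "M \<subseteq> ?I" by blast
    ultimately have "\<not> avoids_powers h ?I"
      using max[OF poly_ideal_sup_principal[OF M], of p] that by blast
    then obtain s m u where "h ^ s = m + u * p" "m \<in> M"
      by (auto simp: avoids_powers_def)
    then have "h ^ s - u * p \<in> M" by simp
    then show ?thesis by blast
  qed
  have prime: "p \<in> M \<or> q \<in> M" if pq: "p * q \<in> M" for p q
  proof (rule ccontr)
    assume "\<not> (p \<in> M \<or> q \<in> M)"
    then obtain s u t v where "h ^ s - u * p \<in> M" "h ^ t - v * q \<in> M"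
      using inv[of p] inv[of q] by blast
    then have "h ^ t * (h ^ s - u * p) + (u * p) * (h ^ t - v * q) + (u * v) * (p * q) \<in> M"
      using pq by (intro add[OF add[OF mult mult] mult])
    moreover have "h ^ t * (h ^ s - u * p) + (u * p) * (h ^ t - v * q) + (u * v) * (p * q) = h ^ (s + t)"
      by (simp add: algebra_simps power_add)
    ultimately have "h ^ (s + t) \<in> M" by simp
    then show False using avoid by (simp add: avoids_powers_def)
  qed
  have "\<exists>a. mvar i - mconst a \<in> M" for i
  proof (rule ccontr)
    assume none: "\<nexists>a. mvar i - mconst a \<in> M"
    then have "\<forall>a. \<exists>s u. h ^ s - u * (mvar i - mconst a) \<in> M"
      using inv by blast
    then obtain s u where su: "\<And>a. h ^ s a - u a * (mvar i - mconst a) \<in> M"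
      by metis
    have "uncountable (UNIV :: complex set)" by (rule uncountable_UNIV_complex)
    then obtain n where n: "uncountable {a \<in> UNIV. s a = n}"
      by (rule uncountable_fibre[OF _ countableI_type])
    obtain B c b where B: "finite B" "B \<subseteq> {a \<in> UNIV. s a = n}" "b \<in> B" "c b \<noteq> 0"
      and dep: "(\<Sum>a\<in>B. mconst (c a) * u a) = 0"
      by (rule uncountable_family_dependent[OF cnt n, of u])
    \<comment> \<open>numerator of \<open>\<Sum> c a / (x - a)\<close>; it is nonzero because its value at \<open>b\<close> has a single nonzero term\<close>
    define q where "q = (\<Sum>a\<in>B. smult (c a) (\<Prod>d\<in>B - {a}. [:- d, 1:]))"
    define \<pi> where "\<pi> = (\<lambda>a. \<Prod>d\<in>B - {a}. mvar i - mconst d)"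
    have \<pi>: "(\<Prod>d\<in>B. mvar i - mconst d) = (mvar i - mconst a) * \<pi> a" if "a \<in> B" for a
      unfolding \<pi>_def by (rule prod.remove) (use B that in auto)
    have q: "uni_eval q (mvar i) = (\<Sum>a\<in>B. mconst (c a) * \<pi> a)"
      by (simp add: q_def \<pi>_def uni_eval_sum uni_eval_smult uni_eval_prod mconst_minus)
    have "(\<Sum>a\<in>B. (mconst (c a) * \<pi> a) * (h ^ n - u a * (mvar i - mconst a))) \<in> M"
    proof (rule poly_ideal_sum[OF M])
      fix a assume "a \<in> B"
      then have "s a = n" using B by auto
      with su[of a] show "(mconst (c a) * \<pi> a) * (h ^ n - u a * (mvar i - mconst a)) \<in> M"
        by (intro mult) simp
    qed
    moreover have "(\<Sum>a\<in>B. (mconst (c a) * \<pi> a) * (h ^ n - u a * (mvar i - mconst a)))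
        = h ^ n * uni_eval q (mvar i) - (\<Sum>a\<in>B. mconst (c a) * u a * ((mvar i - mconst a) * \<pi> a))"
      unfolding q sum_distrib_left sum_subtractf[symmetric] by (rule sum.cong) (simp_all add: algebra_simps)
    moreover have "(\<Sum>a\<in>B. mconst (c a) * u a * ((mvar i - mconst a) * \<pi> a))
        = (\<Sum>a\<in>B. mconst (c a) * u a) * (\<Prod>d\<in>B. mvar i - mconst d)"
      unfolding sum_distrib_right by (rule sum.cong) (simp_all add: \<pi>)
    ultimately have "h ^ n * uni_eval q (mvar i) \<in> M"
      by (simp add: dep)
    then have "uni_eval q (mvar i) \<in> M"
      using prime avoid by (auto simp: avoids_powers_def)
    moreover have "q \<noteq> 0"
    proof -
      have "poly q b = (\<Sum>a\<in>B. c a * (\<Prod>d\<in>B - {a}. b - d))"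
        by (simp add: q_def poly_sum poly_prod)
      also have "\<dots> = c b * (\<Prod>d\<in>B - {b}. b - d)"
      proof (subst sum.remove[OF B(1) B(3)])
        have "(\<Sum>a\<in>B - {b}. c a * (\<Prod>d\<in>B - {a}. b - d)) = 0"
          by (rule sum.neutral) (use B in auto)
        then show "c b * (\<Prod>d\<in>B - {b}. b - d) + (\<Sum>a\<in>B - {b}. c a * (\<Prod>d\<in>B - {a}. b - d))
            = c b * (\<Prod>d\<in>B - {b}. b - d)" by simp
      qed
      also have "\<dots> \<noteq> 0" using B by auto
      finally show ?thesis by auto
    qed
    ultimately show False
      using prime_ideal_uni_eval[OF M one prime] none by blast
  qed
  then obtain x where x: "\<And>i. mvar i - mconst (x i) \<in> M" by metis
  let ?ev = "mpoly_subst (\<lambda>a. a) x"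
  have var: "mvar i ^ k - mconst (x i ^ k) \<in> M" for i k
  proof (induction k)
    case (Suc k)
    have "mvar i ^ Suc k - mconst (x i ^ Suc k)
        = mvar i * (mvar i ^ k - mconst (x i ^ k)) + mconst (x i ^ k) * (mvar i - mconst (x i))"
      by (simp add: algebra_simps mconst_mult)
    then show ?case using add[OF mult[OF Suc] mult[OF x]] by simp
  qed (use poly_ideal_0[OF M] in simp)
  have single: "Poly_Mapping.single \<mu> 1 - mconst (monom_value x \<mu>) \<in> M" for \<mu>
  proof -
    have "(\<Prod>i\<in>A. mvar i ^ Poly_Mapping.lookup \<mu> i) - mconst (\<Prod>i\<in>A. x i ^ Poly_Mapping.lookup \<mu> i) \<in> M"
      if "finite A" for A
      using that
    proof induction
      case empty
      then show ?case using poly_ideal_0[OF M] by simp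
    next
      case (insert i A)
      let ?P = "\<Prod>i\<in>A. mvar i ^ Poly_Mapping.lookup \<mu> i" and ?Q = "\<Prod>i\<in>A. x i ^ Poly_Mapping.lookup \<mu> i"
      let ?k = "Poly_Mapping.lookup \<mu> i"
      have "mvar i ^ ?k * ?P - mconst (x i ^ ?k * ?Q)
          = mvar i ^ ?k * (?P - mconst ?Q) + mconst ?Q * (mvar i ^ ?k - mconst (x i ^ ?k))"
        by (simp add: algebra_simps mconst_mult)
      then show ?case using add[OF mult[OF insert.IH] mult[OF var]] insert.hyps by simp
    qed
    from this[of "Poly_Mapping.keys \<mu>"] show ?thesis
      by (simp add: monom_value_def[of x] flip: monom_value_def[of mvar] monom_value_mvar)
  qed
  have ev: "p - mconst (?ev p) \<in> M" for p
  proof -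
    have "(\<Sum>\<mu>\<in>Poly_Mapping.keys p. mconst (Poly_Mapping.lookup p \<mu>) *
        (Poly_Mapping.single \<mu> 1 - mconst (monom_value x \<mu>))) \<in> M"
      by (intro poly_ideal_sum[OF M] mult single)
    moreover have "(\<Sum>\<mu>\<in>Poly_Mapping.keys p. mconst (Poly_Mapping.lookup p \<mu>) *
        (Poly_Mapping.single \<mu> 1 - mconst (monom_value x \<mu>))) = p - mconst (?ev p)"
      by (simp add: right_diff_distrib sum_subtractf mpoly_subst_def mconst_sum mconst_mult
          mpoly_eq_sum_single flip: single_eq_mconst_mult)
    ultimately show ?thesis by simp
  qed
  show ?thesis
  proof
    fix p assume "p \<in> J"
    then have "mconst (?ev p) \<in> M" using diff[OF _ ev[of p], of p] JM by auto
    then have "mconst (1 / ?ev p) * mconst (?ev p) \<in> M" by (rule mult)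
    then show "?ev p = 0" using one by (auto simp flip: mconst_mult split: if_splits)
  next
    have "h ^ 1 \<notin> M" using avoid unfolding avoids_powers_def by blast
    then have "h \<notin> M" by simp
    then show "?ev h \<noteq> 0" using ev[of h] by auto
  qed
qed

section \<open>Regular functions\<close>

text \<open>
The ideal \<open>J\<close> of all \<open>h\<close> for which \<open>h f\<close> is polynomial on the orbit contains every polynomial that
vanishes on the orbit, as well as, near each point of the orbit, a denominator of \<open>f\<close> that does
not vanish at that point. Its zeros are thus points of the closure outside the orbit, where \<open>Q\<close>
vanishes.
\<close>

theorem regular_function_as_quotient:
  fixes w :: "'n::finite mpoly"
  assumes w: "w \<in> forms D"
    and Q: "\<And>v. v \<in> orbit_closure D w \<Longrightarrow> poly_fun Q v \<noteq> 0 \<Longrightarrow> v \<in> GL_orbit w"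
    and f: "\<And>u. u \<in> GL_orbit w \<Longrightarrow> regular_at D (GL_orbit w) f u"
  obtains s P where "\<And>v. v \<in> GL_orbit w \<Longrightarrow> poly_fun Q v ^ s * f v = poly_fun P v"
proof -
  define J where "J = {h. \<exists>p. \<forall>v\<in>GL_orbit w. poly_fun h v * f v = poly_fun p v}"
  have J: "poly_ideal J"
    unfolding poly_ideal_def
  proof (intro conjI ballI allI)
    show "0 \<in> J" unfolding J_def by (auto intro!: exI[of _ 0])
  next
    fix h h' assume "h \<in> J" "h' \<in> J"
    then obtain p p' where p: "\<And>v. v \<in> GL_orbit w \<Longrightarrow> poly_fun h v * f v = poly_fun p v"
      "\<And>v. v \<in> GL_orbit w \<Longrightarrow> poly_fun h' v * f v = poly_fun p' v" by (auto simp: J_def)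
    then show "h + h' \<in> J"
      unfolding J_def by (auto intro!: exI[of _ "p + p'"] simp: poly_fun_add distrib_right)
  next
    fix h q assume "h \<in> J"
    then obtain p where p: "\<And>v. v \<in> GL_orbit w \<Longrightarrow> poly_fun h v * f v = poly_fun p v"
      by (auto simp: J_def)
    then show "q * h \<in> J"
      unfolding J_def by (auto intro!: exI[of _ "q * p"] simp: poly_fun_mult mult.assoc)
  qed
  have vanishing_in_J: "h \<in> J" if "\<And>v. v \<in> GL_orbit w \<Longrightarrow> poly_fun h v = 0" for h
    unfolding J_def using that by (auto intro!: exI[of _ 0])
  have "\<not> avoids_powers Q J"
  proof
    assume avoid: "avoids_powers Q J"
    have "countable (UNIV :: ('n \<Rightarrow>\<^sub>0 nat) set)"
      by (rule countable_UNIV_poly_mapping_nat) (simp add: countable_finite)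
    then obtain x where x: "\<And>p. p \<in> J \<Longrightarrow> mpoly_subst (\<lambda>a. a) x p = 0" "mpoly_subst (\<lambda>a. a) x Q \<noteq> 0"
      using nullstellensatz_countable[OF _ J avoid] by blast
    \<comment> \<open>The coordinates of other degrees vanish on the orbit and so lie in \<open>J\<close>; hence the zero \<open>x\<close> is a form.\<close>
    have x0: "x \<mu> = 0" if "mdeg \<mu> \<noteq> D" for \<mu>
    proof -
      have "mvar \<mu> \<in> J"
        by (rule vanishing_in_J) (use GL_orbit_forms[OF w] lookup_form_0[OF _ that] in auto)
      from x(1)[OF this] show ?thesis by (simp add: subst_mvar scalar_hom_id)
    qed
    define v where "v = (\<Sum>\<mu>\<in>{\<mu>. mdeg \<mu> = D}. Poly_Mapping.single \<mu> (x \<mu>))"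
    have lv: "Poly_Mapping.lookup v = x"
      using x0 by (auto simp: v_def lookup_sum lookup_single when_def finite_monomials)
    have v: "v \<in> forms D"
      unfolding forms_iff using x0 by (fastforce simp: in_keys_iff lv)
    have zero: "poly_fun p v = 0" if "p \<in> J" for p using x(1)[OF that] by (simp add: poly_fun_def lv)
    have "v \<in> orbit_closure D w"
      unfolding orbit_closure_iff[OF w] using v zero vanishing_in_J by blast
    moreover have "poly_fun Q v \<noteq> 0" using x(2) by (simp add: poly_fun_def lv)
    ultimately have "v \<in> GL_orbit w" by (rule Q)
    from f[OF this] obtain U p q where U: "openin (zariski D) U" "v \<in> U"
      and pq: "\<And>u. u \<in> U \<inter> GL_orbit w \<Longrightarrow> poly_fun q u \<noteq> 0 \<and> f u = poly_fun p u / poly_fun q u"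
      unfolding regular_at_def by blast
    obtain I where I: "U = {v \<in> forms D. \<exists>P\<in>I. poly_fun P v \<noteq> 0}" using U(1) by (auto simp: openin_zariski)
    then obtain r where r: "r \<in> I" "poly_fun r v \<noteq> 0" using U(2) by blast
    \<comment> \<open>\<open>r\<close> vanishes outside the domain \<open>U\<close> of the local fraction, so the equation extends to the whole orbit.\<close>
    have "poly_fun (r * q) u * f u = poly_fun (r * p) u" if u: "u \<in> GL_orbit w" for u
    proof (cases "poly_fun r u = 0")
      case False
      then have "u \<in> U" using I r u GL_orbit_forms[OF w] by blast
      then show ?thesis using pq[of u] u by (simp add: poly_fun_mult)
    qed (simp add: poly_fun_mult)
    then have "r * q \<in> J" unfolding J_def by blast
    from zero[OF this] r pq[of v] U(2) \<open>v \<in> GL_orbit w\<close> show False by (simp add: poly_fun_mult)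
  qed
  then obtain s where "Q ^ s \<in> J" by (auto simp: avoids_powers_def)
  then obtain P where "\<And>v. v \<in> GL_orbit w \<Longrightarrow> poly_fun (Q ^ s) v * f v = poly_fun P v"
    by (auto simp: J_def)
  then show ?thesis using that[of s P] by (simp add: poly_fun_power)
qed

section \<open>Localization of a ring of functions\<close>

lemma fun_ring_simps [simp]:
  "carrier (fun_ring X A) = A"
  "f \<otimes>\<^bsub>fun_ring X A\<^esub> g = (\<lambda>v\<in>X. f v * g v)"
  "f \<oplus>\<^bsub>fun_ring X A\<^esub> g = (\<lambda>v\<in>X. f v + g v)"
  "\<one>\<^bsub>fun_ring X A\<^esub> = (\<lambda>v\<in>X. 1)"
  by (simp_all add: fun_ring_def)

lemma fun_ring_pow:
  "a [^]\<^bsub>fun_ring X A\<^esub> (n::nat) = (\<lambda>v\<in>X. a v ^ n)"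
  by (induction n) (auto simp: nat_pow_def mult.commute cong: restrict_cong)

definition quotient_on :: "'x set \<Rightarrow> ('x \<Rightarrow> complex) \<Rightarrow> ('x \<Rightarrow> complex) \<times> nat \<Rightarrow> 'x \<Rightarrow> complex" where
  "quotient_on U a = (\<lambda>(f, s). \<lambda>v\<in>U. f v / a v ^ s)"

text \<open>
The operations of the localization are unions over all representatives; this collapses such a union
once the result is independent of the representatives.
\<close>

lemma UN_pairs_constant:
  assumes "p \<in> S" "q \<in> T" "\<And>a b c d. (a, b) \<in> S \<Longrightarrow> (c, d) \<in> T \<Longrightarrow> F a b c d = Y"
  shows "(\<Union>(a, b)\<in>S. \<Union>(c, d)\<in>T. F a b c d) = Y"
proof -
  have inner: "(\<Union>(c, d)\<in>T. F a b c d) = Y" if "(a, b) \<in> S" for a b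
  proof -
    have "(\<Union>(c, d)\<in>T. F a b c d) = (\<Union>y\<in>T. Y)"
      using assms(3)[OF that] by (intro SUP_cong refl) auto
    then show ?thesis using assms(2) by auto
  qed
  have "(\<Union>(a, b)\<in>S. \<Union>(c, d)\<in>T. F a b c d) = (\<Union>x\<in>S. Y)"
  proof (intro SUP_cong refl)
    fix x assume "x \<in> S"
    then show "(case x of (a, b) \<Rightarrow> \<Union>(c, d)\<in>T. F a b c d) = Y"
      by (cases x) (simp add: inner)
  qed
  then show ?thesis using assms(1) by auto
qed

text \<open>
By density of \<open>U\<close> in \<open>X\<close>, two fractions are equivalent exactly when they represent the same function
on \<open>U\<close>, so a class is determined by the function that its members represent.
\<close>

theorem localization_iso:
  fixes A :: "('x \<Rightarrow> complex) set"
  assumes UX: "U \<subseteq> X"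
    and one: "(\<lambda>v\<in>X. 1) \<in> A"
    and add: "\<And>f g. f \<in> A \<Longrightarrow> g \<in> A \<Longrightarrow> (\<lambda>v\<in>X. f v + g v) \<in> A"
    and mult: "\<And>f g. f \<in> A \<Longrightarrow> g \<in> A \<Longrightarrow> (\<lambda>v\<in>X. f v * g v) \<in> A"
    and dense: "\<And>f g. f \<in> A \<Longrightarrow> g \<in> A \<Longrightarrow> (\<And>v. v \<in> U \<Longrightarrow> f v = g v) \<Longrightarrow> f = g"
    and a: "a \<in> A" "\<And>v. v \<in> U \<Longrightarrow> a v \<noteq> 0"
  shows "\<exists>h \<in> ring_iso (localization (fun_ring X A) a)
      (fun_ring U {(\<lambda>v\<in>U. f v / a v ^ s) | f s. f \<in> A}).
    \<forall>f\<in>A. \<forall>s. h (fraction (fun_ring X A) a f s) = (\<lambda>v\<in>U. f v / a v ^ s)"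
proof -
  let ?R = "fun_ring X A" and ?q = "quotient_on U a"
  let ?B = "{(\<lambda>v\<in>U. f v / a v ^ s) | f s. f \<in> A}"
  have pow: "(\<lambda>v\<in>X. a v ^ n) \<in> A" for n
  proof (induction n)
    case (Suc n)
    have eq: "(\<lambda>v\<in>X. a v ^ Suc n) = (\<lambda>v\<in>X. a v * (\<lambda>v\<in>X. a v ^ n) v)"
      by (rule restrict_ext) simp
    show ?case unfolding eq by (rule mult[OF a(1) Suc.IH])
  next
    case 0
    show ?case using one by (simp only: power_0)
  qed
  have scale: "(\<lambda>v\<in>X. (\<lambda>v\<in>X. a v ^ u) v * (\<lambda>v\<in>X. (\<lambda>v\<in>X. a v ^ t) v * f v) v)
      = (\<lambda>v\<in>X. a v ^ u * (a v ^ t * f v))" for u t f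
    by (rule restrict_ext) simp
  have times: "(\<lambda>v\<in>X. (\<lambda>v\<in>X. a v ^ n) v * f v) \<in> A" if "f \<in> A" for f n
    by (rule mult[OF pow that])
  have rel: "((f, s), (g, t)) \<in> frac_rel ?R a \<longleftrightarrow> f \<in> A \<and> g \<in> A \<and> ?q (f, s) = ?q (g, t)" for f s g t
  proof -
    have iff: "(\<exists>u. (\<lambda>v\<in>X. a v ^ u * (a v ^ t * f v)) = (\<lambda>v\<in>X. a v ^ u * (a v ^ s * g v)))
        \<longleftrightarrow> ?q (f, s) = ?q (g, t)" if fg: "f \<in> A" "g \<in> A"
    proof
      assume "\<exists>u. (\<lambda>v\<in>X. a v ^ u * (a v ^ t * f v)) = (\<lambda>v\<in>X. a v ^ u * (a v ^ s * g v))"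
      then obtain u where u: "(\<lambda>v\<in>X. a v ^ u * (a v ^ t * f v)) = (\<lambda>v\<in>X. a v ^ u * (a v ^ s * g v))" ..
      have "f v / a v ^ s = g v / a v ^ t" if "v \<in> U" for v
        using fun_cong[OF u, of v] that UX a(2)[OF that] by (auto simp: field_simps)
      then show "?q (f, s) = ?q (g, t)" by (auto simp: quotient_on_def intro: restrict_ext)
    next
      assume q: "?q (f, s) = ?q (g, t)"
      have "(\<lambda>v\<in>X. (\<lambda>v\<in>X. a v ^ t) v * f v) = (\<lambda>v\<in>X. (\<lambda>v\<in>X. a v ^ s) v * g v)"
      proof (rule dense[OF times[OF fg(1)] times[OF fg(2)]])
        fix v assume v: "v \<in> U"
        have "f v / a v ^ s = g v / a v ^ t"
          using fun_cong[OF q, of v] v by (simp add: quotient_on_def)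
        then show "(\<lambda>v\<in>X. (\<lambda>v\<in>X. a v ^ t) v * f v) v = (\<lambda>v\<in>X. (\<lambda>v\<in>X. a v ^ s) v * g v) v"
          using v UX a(2)[OF v] by (auto simp: field_simps)
      qed
      then show "\<exists>u. (\<lambda>v\<in>X. a v ^ u * (a v ^ t * f v)) = (\<lambda>v\<in>X. a v ^ u * (a v ^ s * g v))"
        by (intro exI[of _ 0]) (simp only: scale[symmetric])
    qed
    have "((f, s), (g, t)) \<in> frac_rel ?R a \<longleftrightarrow> f \<in> A \<and> g \<in> A \<and>
        (\<exists>u. (\<lambda>v\<in>X. a v ^ u * (a v ^ t * f v)) = (\<lambda>v\<in>X. a v ^ u * (a v ^ s * g v)))"
      unfolding frac_rel_def fun_ring_simps fun_ring_pow scale mem_Collect_eq prod.inject by blast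
    then show ?thesis using iff by blast
  qed
  have fraction: "fraction ?R a f s = {y. fst y \<in> A \<and> ?q y = ?q (f, s)}" if "f \<in> A" for f s
    using that by (auto simp: fraction_def rel)
  have fraction_cong: "fraction ?R a f s = fraction ?R a g t"
    if "f \<in> A" "g \<in> A" "?q (f, s) = ?q (g, t)" for f s g t
    using that by (simp add: fraction)
  have mem: "(f, s) \<in> fraction ?R a f s" if "f \<in> A" for f s
    using that by (simp add: fraction)
  have carrier: "carrier (localization ?R a) = {fraction ?R a f s | f s. f \<in> A}"
    by (auto simp: localization_def quotient_def fraction_def)
  define h where "h x = ?q (SOME y. y \<in> x)" for x :: "(('x \<Rightarrow> complex) \<times> nat) set"
  have h: "h (fraction ?R a f s) = ?q (f, s)" if "f \<in> A" for f s
  proof -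
    have "(SOME y. y \<in> fraction ?R a f s) \<in> fraction ?R a f s" 
      by (rule someI[where P = "\<lambda>y. y \<in> fraction ?R a f s"]) (rule mem[OF that])
    then show ?thesis unfolding h_def by (simp add: fraction[OF that])
  qed
  have h_in: "h x \<in> ?B" if x: "x \<in> carrier (localization ?R a)" for x
  proof -
    obtain f s where fs: "f \<in> A" "x = fraction ?R a f s" using x unfolding carrier by blast
    then have "h x = (\<lambda>v\<in>U. f v / a v ^ s)" by (simp add: h quotient_on_def)
    with fs(1) show ?thesis by blast
  qed
  have q_mult: "?q (\<lambda>v\<in>X. f v * g v, s + t) = (\<lambda>v\<in>U. ?q (f, s) v * ?q (g, t) v)" for f g s t
    using UX by (auto simp: quotient_on_def power_add intro!: restrict_ext)
  have q_add: "?q (\<lambda>v\<in>X. (\<lambda>v\<in>X. (\<lambda>v\<in>X. a v ^ t) v * f v) v + (\<lambda>v\<in>X. (\<lambda>v\<in>X. a v ^ s) v * g v) v, s + t)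
      = (\<lambda>v\<in>U. ?q (f, s) v + ?q (g, t) v)" for f g s t
    using UX a(2) by (auto simp: quotient_on_def power_add field_simps intro!: restrict_ext)
  have loc_mult: "fraction ?R a f s \<otimes>\<^bsub>localization ?R a\<^esub> fraction ?R a g t
      = fraction ?R a (\<lambda>v\<in>X. f v * g v) (s + t)" if fg: "f \<in> A" "g \<in> A" for f g s t
  proof -
    have "fraction ?R a (\<lambda>v\<in>X. f' v * g' v) (s' + t') = fraction ?R a (\<lambda>v\<in>X. f v * g v) (s + t)"
      if "(f', s') \<in> fraction ?R a f s" "(g', t') \<in> fraction ?R a g t" for f' s' g' t'
      using that fg by (intro fraction_cong mult) (auto simp: fraction q_mult)
    then have "(\<Union>(f', s')\<in>fraction ?R a f s. \<Union>(g', t')\<in>fraction ?R a g t.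
        fraction ?R a (\<lambda>v\<in>X. f' v * g' v) (s' + t')) = fraction ?R a (\<lambda>v\<in>X. f v * g v) (s + t)"
      by (rule UN_pairs_constant[OF mem[OF fg(1)] mem[OF fg(2)]])
    then show ?thesis by (simp add: localization_def)
  qed
  let ?add = "\<lambda>f s g t. \<lambda>v\<in>X. (\<lambda>v\<in>X. (\<lambda>v\<in>X. a v ^ t) v * f v) v + (\<lambda>v\<in>X. (\<lambda>v\<in>X. a v ^ s) v * g v) v"
  have add_in: "?add f s g t \<in> A" if "f \<in> A" "g \<in> A" for f s g t
    by (intro add times that)
  have loc_add: "fraction ?R a f s \<oplus>\<^bsub>localization ?R a\<^esub> fraction ?R a g t
      = fraction ?R a (?add f s g t) (s + t)" if fg: "f \<in> A" "g \<in> A" for f g s t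
  proof -
    have "fraction ?R a (?add f' s' g' t') (s' + t') = fraction ?R a (?add f s g t) (s + t)"
      if "(f', s') \<in> fraction ?R a f s" "(g', t') \<in> fraction ?R a g t" for f' s' g' t'
      using that fg by (intro fraction_cong add_in) (auto simp only: fraction q_add fst_conv mem_Collect_eq)
    then have "(\<Union>(f', s')\<in>fraction ?R a f s. \<Union>(g', t')\<in>fraction ?R a g t.
        fraction ?R a (?add f' s' g' t') (s' + t')) = fraction ?R a (?add f s g t) (s + t)"
      by (rule UN_pairs_constant[OF mem[OF fg(1)] mem[OF fg(2)]])
    then show ?thesis by (simp only: localization_def fun_ring_simps fun_ring_pow ring.simps)
  qed
  have "h \<in> ring_hom (localization ?R a) (fun_ring U ?B)"
  proof (rule ring_hom_memI)
    show "h x \<in> carrier (fun_ring U ?B)" if "x \<in> carrier (localization ?R a)" for x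
      using h_in[OF that] by simp
  next
    fix x y assume "x \<in> carrier (localization ?R a)" "y \<in> carrier (localization ?R a)"
    then obtain f s g t where xy: "x = fraction ?R a f s" "y = fraction ?R a g t" "f \<in> A" "g \<in> A"
      by (auto simp: carrier)
    show "h (x \<otimes>\<^bsub>localization ?R a\<^esub> y) = h x \<otimes>\<^bsub>fun_ring U ?B\<^esub> h y"
      using xy(3,4) by (simp add: xy(1,2) loc_mult h mult q_mult)
    show "h (x \<oplus>\<^bsub>localization ?R a\<^esub> y) = h x \<oplus>\<^bsub>fun_ring U ?B\<^esub> h y"
      unfolding xy(1,2) loc_add[OF xy(3,4)] h[OF add_in[OF xy(3,4)]] h[OF xy(3)] h[OF xy(4)] q_add
      by simp
  next
    have "h (fraction ?R a (\<lambda>v\<in>X. 1) 0) = (\<lambda>v\<in>U. 1)"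
      using UX by (auto simp: h one quotient_on_def intro!: restrict_ext)
    then show "h \<one>\<^bsub>localization ?R a\<^esub> = \<one>\<^bsub>fun_ring U ?B\<^esub>"
      by (simp add: localization_def)
  qed
  moreover have "bij_betw h (carrier (localization ?R a)) (carrier (fun_ring U ?B))"
    unfolding bij_betw_def
  proof
    show "inj_on h (carrier (localization ?R a))"
    proof (rule inj_onI)
      fix x y assume "x \<in> carrier (localization ?R a)" "y \<in> carrier (localization ?R a)" and eq: "h x = h y"
      then obtain f s g t where xy: "x = fraction ?R a f s" "y = fraction ?R a g t" "f \<in> A" "g \<in> A"
        unfolding carrier by blast
      show "x = y"
        unfolding xy(1,2) using eq xy by (intro fraction_cong) (simp_all add: h)
    qed
    show "h ` carrier (localization ?R a) = carrier (fun_ring U ?B)"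
    proof
      show "h ` carrier (localization ?R a) \<subseteq> carrier (fun_ring U ?B)"
        using h_in by auto
      show "carrier (fun_ring U ?B) \<subseteq> h ` carrier (localization ?R a)"
      proof
        fix b assume "b \<in> carrier (fun_ring U ?B)"
        then obtain f s where "f \<in> A" "b = (\<lambda>v\<in>U. f v / a v ^ s)" by auto
        then have "f \<in> A" "b = ?q (f, s)" by (simp_all add: quotient_on_def)
        then have "b = h (fraction ?R a f s)" "fraction ?R a f s \<in> carrier (localization ?R a)"
          by (auto simp: h carrier)
        then show "b \<in> h ` carrier (localization ?R a)" by blast
      qed
    qed
  qed
  ultimately have "h \<in> ring_iso (localization ?R a) (fun_ring U ?B)"
    by (simp add: ring_iso_def)
  moreover have "\<forall>f\<in>A. \<forall>s. h (fraction ?R a f s) = (\<lambda>v\<in>U. f v / a v ^ s)"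
    by (simp add: h quotient_on_def)
  ultimately show ?thesis by blast
qed

section \<open>The orbit as a principal open subset\<close>

lemma carrier_regular_ring_orbit:
  assumes D: "D \<ge> 1" and w: "w \<in> forms D" "polystable D w"
    and \<Phi>: "\<Phi> \<in> SL_invariants (orbit_closure D w) e" "\<Phi> w = 1" and e: "e > 0"
  shows "carrier (regular_ring D (GL_orbit w)) =
    {(\<lambda>v\<in>GL_orbit w. f v / \<Phi> v ^ s) | f s. f \<in> carrier (coord_ring (orbit_closure D w))}"
proof -
  let ?X = "orbit_closure D w" and ?O = "GL_orbit w"
  obtain Q where Q: "\<Phi> = restrict (poly_fun Q) ?X"
    using \<Phi>(1) unfolding SL_invariants_iff by blast
  have OX: "v \<in> ?X" if "v \<in> ?O" for v using that GL_orbit_subset_closure[OF w(1)] by blast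
  have \<Phi>_nz: "\<Phi> v \<noteq> 0" if "v \<in> ?O" for v
    by (rule invariant_nonzero_on_orbit[OF w(1) \<Phi> that])
  have Q_nz: "v \<in> ?O" if "v \<in> ?X" "poly_fun Q v \<noteq> 0" for v
    using nonvanishing_imp_orbit[OF D w \<Phi> e that(1)] that by (simp add: Q)
  have carrier: "carrier (coord_ring ?X) = range (\<lambda>P. restrict (poly_fun P) ?X)"
    by (simp add: coord_ring_def)
  show ?thesis
  proof
    show "carrier (regular_ring D ?O) \<subseteq> {(\<lambda>v\<in>?O. f v / \<Phi> v ^ s) | f s. f \<in> carrier (coord_ring ?X)}"
    proof
      fix f assume "f \<in> carrier (regular_ring D ?O)"
      then have f: "f \<in> extensional ?O" "\<And>u. u \<in> ?O \<Longrightarrow> regular_at D ?O f u"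
        by (simp_all add: regular_ring_def)
      obtain s P where sP: "\<And>v. v \<in> ?O \<Longrightarrow> poly_fun Q v ^ s * f v = poly_fun P v"
        using regular_function_as_quotient[OF w(1) Q_nz f(2)] by blast
      have "f = (\<lambda>v\<in>?O. restrict (poly_fun P) ?X v / \<Phi> v ^ s)"
      proof (rule extensionalityI[OF f(1) restrict_extensional])
        fix v assume v: "v \<in> ?O"
        then have "\<Phi> v ^ s * f v = poly_fun P v" using sP[OF v] OX[OF v] by (simp add: Q)
        then show "f v = (\<lambda>v\<in>?O. restrict (poly_fun P) ?X v / \<Phi> v ^ s) v"
          using v OX[OF v] \<Phi>_nz[OF v] by (simp add: field_simps)
      qed
      then show "f \<in> {(\<lambda>v\<in>?O. f v / \<Phi> v ^ s) | f s. f \<in> carrier (coord_ring ?X)}"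
        unfolding carrier by blast
    qed
    show "{(\<lambda>v\<in>?O. f v / \<Phi> v ^ s) | f s. f \<in> carrier (coord_ring ?X)} \<subseteq> carrier (regular_ring D ?O)"
    proof
      fix g assume "g \<in> {(\<lambda>v\<in>?O. f v / \<Phi> v ^ s) | f s. f \<in> carrier (coord_ring ?X)}"
      then obtain P s where g: "g = (\<lambda>v\<in>?O. restrict (poly_fun P) ?X v / \<Phi> v ^ s)"
        unfolding carrier by blast
      have "regular_at D ?O g u" if u: "u \<in> ?O" for u
        unfolding regular_at_def
      proof (intro exI conjI ballI)
        show "openin (zariski D) (forms D)" using openin_topspace[of "zariski D"] by simp
        show "u \<in> forms D" using u GL_orbit_forms[OF w(1)] by blast
        fix v assume v: "v \<in> forms D \<inter> ?O"
        then have "\<Phi> v = poly_fun Q v" using OX by (simp add: Q)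
        moreover have "\<Phi> v \<noteq> 0" using v \<Phi>_nz by blast
        ultimately show "poly_fun (Q ^ s) v \<noteq> 0" "g v = poly_fun P v / poly_fun (Q ^ s) v"
          using v OX by (simp_all add: g poly_fun_power)
      qed
      then show "g \<in> carrier (regular_ring D ?O)" by (simp add: regular_ring_def g)
    qed
  qed
qed

theorem proposition3p9:
  fixes D :: nat and w :: "'n::finite mpoly" and \<Phi> :: "'n mpoly \<Rightarrow> complex"
  assumes "D \<ge> 1"
    and "w \<in> forms D" and "w \<noteq> 0" and "polystable D w"
    and "fundamental_invariant D w \<Phi>"
  shows
    "{v \<in> orbit_closure D w. \<Phi> v = 0} = orbit_closure D w - GL_orbit w
     \<and>
     carrier (regular_ring D (GL_orbit w)) =
       {(\<lambda>v\<in>GL_orbit w. f v / \<Phi> v ^ s) | f s. f \<in> carrier (coord_ring (orbit_closure D w))}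
     \<and>
     (\<exists>h \<in> ring_iso (localization (coord_ring (orbit_closure D w)) \<Phi>) (regular_ring D (GL_orbit w)).
        \<forall>f \<in> carrier (coord_ring (orbit_closure D w)). \<forall>s.
          h (fraction (coord_ring (orbit_closure D w)) \<Phi> f s) = (\<lambda>v\<in>GL_orbit w. f v / \<Phi> v ^ s))"
proof (intro conjI)
  let ?X = "orbit_closure D w" and ?O = "GL_orbit w"
  let ?A = "range (\<lambda>P. restrict (poly_fun P) ?X)"
  let ?B = "{(\<lambda>v\<in>?O. f v / \<Phi> v ^ s) | f s. f \<in> ?A}"
  note D = assms(1) and w = assms(2)
  have e: "minimal_degree D w > 0" by (rule minimal_degree_pos[OF assms(1-4)])
  have \<Phi>: "\<Phi> \<in> SL_invariants ?X (minimal_degree D w)" "\<Phi> w = 1"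
    using assms(5) by (simp_all add: fundamental_invariant_def)
  have nz: "\<Phi> v \<noteq> 0" if "v \<in> ?O" for v
    by (rule invariant_nonzero_on_orbit[OF w \<Phi> that])
  show "{v \<in> ?X. \<Phi> v = 0} = ?X - ?O"
    using nz nonvanishing_imp_orbit[OF D w assms(4) \<Phi> e] by blast
  have A: "carrier (coord_ring ?X) = ?A" by (simp add: coord_ring_def)
  show carrier: "carrier (regular_ring D ?O) = {(\<lambda>v\<in>?O. f v / \<Phi> v ^ s) | f s. f \<in> carrier (coord_ring ?X)}"
    by (rule carrier_regular_ring_orbit[OF D w assms(4) \<Phi> e])
  have R: "regular_ring D ?O = fun_ring ?O ?B"
    using carrier unfolding A by (simp add: regular_ring_def)
  have "\<exists>h \<in> ring_iso (localization (fun_ring ?X ?A) \<Phi>) (fun_ring ?O ?B).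
      \<forall>f\<in>?A. \<forall>s. h (fraction (fun_ring ?X ?A) \<Phi> f s) = (\<lambda>v\<in>?O. f v / \<Phi> v ^ s)"
  proof (rule localization_iso)
    show "?O \<subseteq> ?X" by (rule GL_orbit_subset_closure[OF w])
    have "(\<lambda>v\<in>?X. 1) = restrict (poly_fun 1) ?X" by (rule restrict_ext) simp
    then show "(\<lambda>v\<in>?X. 1) \<in> ?A" by blast
    fix f g assume "f \<in> ?A" "g \<in> ?A"
    then obtain P Q where fg: "f = restrict (poly_fun P) ?X" "g = restrict (poly_fun Q) ?X" by blast
    have "(\<lambda>v\<in>?X. f v + g v) = restrict (poly_fun (P + Q)) ?X"
      by (rule restrict_ext) (simp add: fg poly_fun_add)
    then show "(\<lambda>v\<in>?X. f v + g v) \<in> ?A" by blast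
    have "(\<lambda>v\<in>?X. f v * g v) = restrict (poly_fun (P * Q)) ?X"
      by (rule restrict_ext) (simp add: fg poly_fun_mult)
    then show "(\<lambda>v\<in>?X. f v * g v) \<in> ?A" by blast
    assume eq: "\<And>v. v \<in> ?O \<Longrightarrow> f v = g v"
    show "f = g"
      unfolding fg
    proof (rule restrict_ext)
      fix v assume v: "v \<in> ?X"
      have "poly_fun P v + (- 1) * poly_fun Q v = 0"
      proof (rule polyfn_zero_on_closure[OF w _ _ v])
        show "polyfn D (\<lambda>v. poly_fun P v + (- 1) * poly_fun Q v)"
          by (intro polyfn_add polyfn_mult polyfn_const polyfn_poly_fun)
        show "poly_fun P u + (- 1) * poly_fun Q u = 0" if "u \<in> ?O" for u
          using eq[OF that] that GL_orbit_subset_closure[OF w] by (simp add: fg subset_iff)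
      qed
      then show "poly_fun P v = poly_fun Q v" by simp
    qed
  next
    show "\<Phi> \<in> ?A" using \<Phi>(1) unfolding SL_invariants_iff by blast
  qed (rule nz)
  then show "\<exists>h \<in> ring_iso (localization (coord_ring ?X) \<Phi>) (regular_ring D ?O).
      \<forall>f \<in> carrier (coord_ring ?X). \<forall>s. h (fraction (coord_ring ?X) \<Phi> f s) = (\<lambda>v\<in>?O. f v / \<Phi> v ^ s)"
    unfolding R A unfolding coord_ring_def .
qed

end
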